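(* For any $0<r<\log 1.01$, $$\mu\Big(\bigcup_{0\le s<1}a_{-s}K_r\Big)\asymp r\log\Big(\frac1r\Big),$$ i.e. the left side is bounded above and below by absolute positive constant multiples of $r\log(1/r)$.
   Context: $X=\mathrm{SL}_2(\mathbb{R})/\mathrm{SL}_2(\mathbb{Z})$ is the space of unimodular lattices in $\mathbb{R}^2$, and $\mu$ is the $\mathrm{SL}_2(\mathbb{R})$-invariant probability measure on $X$. $\|\cdot\|$ denotes the supremum norm on $\mathbb{R}^2$. For $\Lambda\in X$ let $\Delta(\Lambda)=\sup_{v\in\Lambda\smallsetminus\{0\}}\log(1/\|v\|)$, and for $r\ge0$ let $K_r=\Delta^{-1}([0,r])$. For $s\in\mathbb{R}$, $a_s=\mathrm{diag}(e^s,e^{-s})$, acting on $X$ by left multiplication. *)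

theory Defs
  imports "HOL-Probability.Probability"
begin

definition SL2 :: "(real^2^2) set" where
  "SL2 = {g. det g = 1}"

definition Zsq :: "(real^2) set" where
  "Zsq = {v. \<forall>i. v $ i \<in> \<int>}"

definition lattice_of :: "real^2^2 \<Rightarrow> (real^2) set" where
  "lattice_of g = (\<lambda>v. g *v v) ` Zsq"

text \<open>X = SL_2(R)/SL_2(Z), realised as the set of unimodular lattices g Z^2.\<close>
definition Xspace :: "(real^2) set set" where
  "Xspace = lattice_of ` SL2"

definition act :: "real^2^2 \<Rightarrow> (real^2) set \<Rightarrow> (real^2) set" where
  "act g L = (\<lambda>v. g *v v) ` L"

definition diag_a :: "real \<Rightarrow> real^2^2" where
  "diag_a s = (\<chi> i j. if i = j then (if i = 1 then exp s else exp (- s)) else 0)"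

definition Delta :: "(real^2) set \<Rightarrow> real" where
  "Delta L = (SUP v \<in> L - {0}. ln (1 / infnorm v))"

definition Kset :: "real \<Rightarrow> (real^2) set set" where
  "Kset r = {L \<in> Xspace. Delta L \<le> r}"

definition Uset :: "real \<Rightarrow> (real^2) set set" where
  "Uset r = (\<Union>s\<in>{0..<1}. act (diag_a (- s)) ` Kset r)"

text \<open>Quotient sigma-algebra on X: A is measurable iff its preimage in SL_2(R) is Borel.\<close>
definition Xsets :: "(real^2) set set set" where
  "Xsets = {A. A \<subseteq> Xspace \<and> {g \<in> SL2. lattice_of g \<in> A} \<in> sets borel}"

definition invariant_prob_X :: "(real^2) set measure \<Rightarrow> bool" where
  "invariant_prob_X M \<longleftrightarrow> prob_space M \<and> space M = Xspace \<and> sets M = Xsets \<and>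
     (\<forall>g\<in>SL2. \<forall>A\<in>sets M. emeasure M (act g ` A) = emeasure M A)"

end

theory Submission
  imports Defs "HOL-Analysis.Kronecker_Approximation_Theorem"
begin

text \<open>
  An invariant probability measure \<open>M\<close> on the space of lattices lifts to a left-invariant measure on
  \<open>SL2\<close>, namely \<open>E \<mapsto> \<integral> #{g \<in> E. g Z\<^sup>2 = L} dM(L)\<close>. It is proportional to the cone measure
  \<open>haar\<close>, whose density in the coordinates \<open>a, b, c\<close> of the matrix with rows \<open>(a, b)\<close>, \<open>(c, d)\<close> is a
  multiple of \<open>1 / \<bar>a\<bar>\<close>; the factor is bounded above because bounded sets of \<open>SL2\<close> cover the quotient
  with bounded multiplicity, and below because a set of finite \<open>haar\<close> measure covers the quotient.

  A unimodular lattice avoids an origin-symmetric open box with sides \<open>2 e\<^sup>-\<^sup>s\<^sup>-\<^sup>r\<close> and \<open>2 e\<^sup>s\<^sup>-\<^sup>r\<close> only if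
  two consecutive minimal points \<open>(a, c)\<close>, \<open>(b, d)\<close> form a basis with \<open>-2 r \<le> b c \<le> 0\<close>, and conversely
  \<open>e\<^sup>-\<^sup>r - 1 \<le> b c \<le> 0\<close> suffices (take \<open>e\<^sup>-\<^sup>s = a\<close>). As \<open>s\<close> varies, \<open>a\<close> ranges over an interval of
  constant length, so the measure is comparable to the area of \<open>{\<bar>b c\<bar> \<le> r}\<close> in a square,
  which is of order \<open>r log (1 / r)\<close>.
\<close>

section \<open>Minimal points of plane lattices\<close>

text \<open>The final constants may not depend on \<open>M\<close>, which is known only through its
  invariance. So \<open>M\<close> is never identified: the proportionality of \<open>lifted\<close>
  and \<open>haar\<close> is read off on one reference set, \<open>SL2_box 2\<close>, and the factor
  is bounded on both sides by numbers that do not involve \<open>M\<close>. Since only orders of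
  magnitude matter, neither a fundamental domain nor an exact normalisation enters, and
  \<open>cover_bound 2\<close> is never evaluated.

  The cone measure is preferred to an explicit density because its invariance reduces to shears of
  Lebesgue measure, without any change of variables formula. The factor 1 / |a| appears only when
  the last matrix entry is integrated out.

  The logarithm is the area next to a hyperbola: for \<open>b\<close> between \<delta> and 1 the
  admissible \<open>c\<close> fill an interval of length \<delta> / b. The bound on \<open>r\<close>
  makes \<open>ln (1 / r)\<close> at least 1, so that terms linear in \<open>r\<close> are
  absorbed.\<close>

lemma finite_int_pairs_in_box:
  fixes a b c d R T :: real
  assumes det: "a * d - b * c = 1"
  shows "finite {z :: int \<times> int. \<bar>a * of_int (fst z) + b * of_int (snd z)\<bar> \<le> R \<and> \<bar>c * of_int (fst z) + d * of_int (snd z)\<bar> \<le> T}" (is "finite ?A")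
proof -
  define K where "K = \<lceil>(\<bar>d\<bar> + \<bar>c\<bar>) * \<bar>R\<bar> + (\<bar>b\<bar> + \<bar>a\<bar>) * \<bar>T\<bar>\<rceil>"
  have "?A \<subseteq> {-K..K} \<times> {-K..K}"
  proof
    fix z assume z: "z \<in> ?A"
    define x y where "x = a * of_int (fst z) + b * of_int (snd z)" and "y = c * of_int (fst z) + d * of_int (snd z)"
    have xy: "\<bar>x\<bar> \<le> \<bar>R\<bar>" "\<bar>y\<bar> \<le> \<bar>T\<bar>" using z by (auto simp: x_def y_def)
    have "d * x - b * y = (a * d - b * c) * fst z" "a * y - c * x = (a * d - b * c) * snd z"
      by (simp_all add: x_def y_def algebra_simps)
    then have e: "real_of_int (fst z) = d * x - b * y" "real_of_int (snd z) = a * y - c * x"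
      by (simp_all add: det)
    have m: "\<bar>p * x\<bar> \<le> \<bar>p\<bar> * \<bar>R\<bar>" "\<bar>p * y\<bar> \<le> \<bar>p\<bar> * \<bar>T\<bar>" for p :: real
      using xy by (simp_all add: abs_mult mult_left_mono)
    have nn: "0 \<le> \<bar>p\<bar> * \<bar>R\<bar>" "0 \<le> \<bar>p\<bar> * \<bar>T\<bar>" for p :: real by simp_all
    have KK: "(\<bar>d\<bar> + \<bar>c\<bar>) * \<bar>R\<bar> + (\<bar>b\<bar> + \<bar>a\<bar>) * \<bar>T\<bar> \<le> real_of_int K"
      unfolding K_def by (rule le_of_int_ceiling)
    have "\<bar>real_of_int (fst z)\<bar> \<le> real_of_int K"
      using KK m(1)[of d] m(2)[of b] nn(1)[of c] nn(2)[of a] unfolding e distrib_right by linarith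
    moreover have "\<bar>real_of_int (snd z)\<bar> \<le> real_of_int K"
      using KK m(1)[of c] m(2)[of a] nn(1)[of d] nn(2)[of b] unfolding e distrib_right by linarith
    ultimately have "\<bar>fst z\<bar> \<le> K" "\<bar>snd z\<bar> \<le> K" by linarith+
    then show "z \<in> {-K..K} \<times> {-K..K}" by (cases z) auto
  qed
  then show ?thesis by (rule finite_subset) simp
qed

lemma ex_minimiser_finite_sublevel:
  fixes f :: "'a \<Rightarrow> real"
  assumes "z0 \<in> S" "finite {z \<in> S. f z \<le> f z0}"
  obtains z where "z \<in> S" "\<And>z'. z' \<in> S \<Longrightarrow> f z \<le> f z'"
proof -
  let ?T = "{z \<in> S. f z \<le> f z0}"
  have ne: "?T \<noteq> {}" using assms(1) by auto
  have fin: "finite (f ` ?T)" using assms(2) by simp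
  have "Min (f ` ?T) \<in> f ` ?T" using fin ne by (intro Min_in) auto
  then obtain z where z: "z \<in> ?T" "f z = Min (f ` ?T)" by auto
  have "f z \<le> f z'" if "z' \<in> S" for z'
  proof (cases "f z' \<le> f z0")
    case True
    then show ?thesis using z(2) fin that by simp
  next
    case False
    then show ?thesis using z(1) by auto
  qed
  then show thesis using that z(1) by blast
qed

text \<open>Dirichlet approximation of d / c. It guarantees that every strip around a line through
  the origin, however thin, contains a nonzero lattice point, so that both minimisations below have
  a candidate.\<close>

lemma ex_int_pair_small_form:
  fixes c d \<beta> :: real
  assumes "\<beta> > 0"
  obtains z :: "int \<times> int" where "z \<noteq> (0, 0)" "\<bar>c * of_int (fst z) + d * of_int (snd z)\<bar> < \<beta>"
proof (cases "c = 0")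
  case True
  then show ?thesis using that[of "(1, 0)"] assms by simp
next
  case False
  obtain N :: nat where N: "\<bar>c\<bar> / \<beta> < real N" using reals_Archimedean2 by blast
  have "0 \<le> \<bar>c\<bar> / \<beta>" using assms by simp
  with N have N0: "N > 0" by (cases N) auto
  obtain h k :: int where k: "0 < k" "k \<le> int N" "\<bar>of_int k * (d / c) - of_int h\<bar> < 1 / N"
    using Dirichlet_approx[OF N0, of "d / c"] by blast
  have "\<bar>c * of_int (- h) + d * of_int k\<bar> = \<bar>c\<bar> * \<bar>of_int k * (d / c) - of_int h\<bar>"
    using False by (simp add: abs_mult[symmetric] field_simps)
  also have "\<dots> < \<bar>c\<bar> * (1 / N)" using k(3) False by (intro mult_strict_left_mono) auto
  also have "\<dots> < \<beta>" using N N0 assms by (simp add: field_simps)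
  finally show ?thesis using that[of "(-h, k)"] k(1) by simp
qed

text \<open>The two basis vectors are consecutive minimal points of the lattice: the first minimises
  \<open>\<bar>x\<bar>\<close> subject to \<open>\<bar>y\<bar> < \<beta>\<close>, the second minimises \<open>\<bar>y\<bar>\<close> subject to \<open>\<bar>x\<bar>\<close> being smaller than that
  of the first. No lattice point lies strictly inside the box they span, which forces \<open>b * c \<le> 0\<close>
  and makes them a basis.\<close>

lemma minimal_points_basis:
  fixes a b c d \<beta> :: real
  assumes det: "a * d - b * c = 1" and "\<beta> > 0"
    and novert: "\<And>(m :: int) (n :: int). m \<noteq> 0 \<or> n \<noteq> 0 \<Longrightarrow> a * of_int m + b * of_int n = 0 \<Longrightarrow> \<beta> \<le> \<bar>c * of_int m + d * of_int n\<bar>"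
  obtains p q r s :: int where "p * s - q * r = 1"
    "0 < a * p + b * r" "\<bar>a * q + b * s\<bar> < a * p + b * r"
    "\<bar>c * p + d * r\<bar> < \<beta>" "\<beta> \<le> c * q + d * s"
    "(a * q + b * s) * (c * p + d * r) \<le> 0"
proof -
  define X Y :: "int \<times> int \<Rightarrow> real"
    where "X z = a * of_int (fst z) + b * of_int (snd z)" and "Y z = c * of_int (fst z) + d * of_int (snd z)" for z
  have X_simps: "X (m, n) = a * m + b * n" "X (z + w) = X z + X w" "X (z - w) = X z - X w" "X (- z) = - X z" for m n z w
    by (simp_all add: X_def algebra_simps)
  have Y_simps: "Y (m, n) = c * m + d * n" "Y (z + w) = Y z + Y w" "Y (z - w) = Y z - Y w" "Y (- z) = - Y z" for m n z w
    by (simp_all add: Y_def algebra_simps)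
  have fin: "finite {z. \<bar>X z\<bar> \<le> R \<and> \<bar>Y z\<bar> \<le> T}" for R T
    using finite_int_pairs_in_box[OF det] by (simp add: X_def Y_def)

  define S1 where "S1 = {z. z \<noteq> 0 \<and> \<bar>Y z\<bar> < \<beta>}"
  obtain z0 :: "int \<times> int" where "z0 \<noteq> (0, 0)" "\<bar>c * of_int (fst z0) + d * of_int (snd z0)\<bar> < \<beta>"
    using ex_int_pair_small_form[OF \<open>\<beta> > 0\<close>] .
  then have z0: "z0 \<in> S1" by (simp add: S1_def Y_def zero_prod_def)
  have "finite {z \<in> S1. \<bar>X z\<bar> \<le> \<bar>X z0\<bar>}"
    by (rule finite_subset[OF _ fin[of "\<bar>X z0\<bar>" \<beta>]]) (auto simp: S1_def)
  then obtain z1' where z1': "z1' \<in> S1" "\<And>z. z \<in> S1 \<Longrightarrow> \<bar>X z1'\<bar> \<le> \<bar>X z\<bar>"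
    using ex_minimiser_finite_sublevel[OF z0, of "\<lambda>z. \<bar>X z\<bar>"] by metis
  define z1 where "z1 = (if X z1' < 0 then - z1' else z1')"
  have z1: "z1 \<in> S1" "X z1 = \<bar>X z1'\<bar>"
    using z1'(1) by (auto simp: z1_def S1_def X_simps Y_simps)
  have min1: "X z1 \<le> \<bar>X z\<bar>" if "z \<in> S1" for z using z1'(2)[OF that] z1(2) by simp
  \<comment> \<open>\<open>novert\<close> enters here only: it excludes a vertical vector in the
    strip, so that the strip for the second minimisation has positive width.\<close>
  have "X z1 \<noteq> 0"
    using novert[of "fst z1" "snd z1"] z1(1) by (auto simp: S1_def X_def Y_def zero_prod_def prod_eq_iff)
  with z1(2) have X1: "X z1 > 0" by simp

  define S2 where "S2 = {z. z \<noteq> 0 \<and> \<bar>X z\<bar> < X z1}"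
  obtain w0 :: "int \<times> int" where "w0 \<noteq> (0, 0)" "\<bar>a * of_int (fst w0) + b * of_int (snd w0)\<bar> < X z1"
    using ex_int_pair_small_form[OF X1] .
  then have w0: "w0 \<in> S2" by (simp add: S2_def X_def zero_prod_def)
  have "finite {z \<in> S2. \<bar>Y z\<bar> \<le> \<bar>Y w0\<bar>}"
    by (rule finite_subset[OF _ fin[of "X z1" "\<bar>Y w0\<bar>"]]) (auto simp: S2_def)
  then obtain z2' where z2': "z2' \<in> S2" "\<And>z. z \<in> S2 \<Longrightarrow> \<bar>Y z2'\<bar> \<le> \<bar>Y z\<bar>"
    using ex_minimiser_finite_sublevel[OF w0, of "\<lambda>z. \<bar>Y z\<bar>"] by metis
  define z2 where "z2 = (if Y z2' < 0 then - z2' else z2')"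
  have z2: "z2 \<in> S2" "Y z2 = \<bar>Y z2'\<bar>"
    using z2'(1) by (auto simp: z2_def S2_def X_simps Y_simps)
  have min2: "Y z2 \<le> \<bar>Y z\<bar>" if "z \<in> S2" for z using z2'(2)[OF that] z2(2) by simp
  have Y2: "\<beta> \<le> Y z2"
  proof (rule ccontr)
    assume "\<not> \<beta> \<le> Y z2"
    then have "z2 \<in> S1" using z2 by (auto simp: S1_def S2_def)
    from min1[OF this] show False using z2(1) by (simp add: S2_def)
  qed
  have Y1: "\<bar>Y z1\<bar> < \<beta>" and X2: "\<bar>X z2\<bar> < X z1" using z1(1) z2(1) by (auto simp: S1_def S2_def)

  have X0: "z \<noteq> 0" if "X z \<noteq> 0" for z using that by (auto simp: X_def)
  \<comment> \<open>If the two coordinates had the same strict sign, the difference or the sum of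
    the two vectors would still lie in \<open>S2\<close> and have smaller \<open>Y\<close> than
    \<open>z2\<close>.\<close>
  have opp: "X z2 * Y z1 \<le> 0"
  proof (rule ccontr)
    assume "\<not> ?thesis"
    then consider "X z2 > 0" "Y z1 > 0" | "X z2 < 0" "Y z1 < 0" by (auto simp: zero_less_mult_iff not_le)
    then show False
    proof cases
      case 1
      then have "z1 - z2 \<in> S2" using X2 X0[of "z1 - z2"] by (auto simp: S2_def X_simps)
      from min2[OF this] show False using 1 Y1 Y2 by (auto simp: Y_simps)
    next
      case 2
      then have "z1 + z2 \<in> S2" using X2 X0[of "z1 + z2"] by (auto simp: S2_def X_simps)
      from min2[OF this] show False using 2 Y1 Y2 by (auto simp: Y_simps)
    qed
  qed
  define p r q s where "p = fst z1" and "r = snd z1" and "q = fst z2" and "s = snd z2"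
  define D where "D = p * s - q * r"
  have D: "real_of_int D = X z1 * Y z2 - X z2 * Y z1"
  proof -
    have "X z1 * Y z2 - X z2 * Y z1 = (a * d - b * c) * real_of_int D"
      by (simp add: X_def Y_def D_def p_def q_def r_def s_def algebra_simps)
    then show ?thesis by (simp add: det)
  qed
  have "0 < X z1 * Y z2" using X1 Y2 \<open>\<beta> > 0\<close> by simp
  with D opp have Dpos: "D > 0" by linarith

  \<comment> \<open>Rounding the real coordinates of \<open>z\<close> leaves a remainder with
    coefficients at most 1/2. Since |X z2| < X z1 and |Y z1| < Y z2, it lies strictly inside the box
    of the two minimal points, hence vanishes by \<open>min2\<close>.\<close>
  have span: "\<exists>(m :: int) (n :: int). p * m + q * n = fst z \<and> r * m + s * n = snd z" for z :: "int \<times> int"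
  proof -
    define \<sigma> \<tau> where "\<sigma> = (X z * Y z2 - X z2 * Y z) / D" and "\<tau> = (X z1 * Y z - X z * Y z1) / D"
    have "\<sigma> * X z1 + \<tau> * X z2 = X z * ((X z1 * Y z2 - X z2 * Y z1) / D)"
      "\<sigma> * Y z1 + \<tau> * Y z2 = Y z * ((X z1 * Y z2 - X z2 * Y z1) / D)"
      using Dpos by (simp_all add: \<sigma>_def \<tau>_def field_simps)
    then have comb: "\<sigma> * X z1 + \<tau> * X z2 = X z" "\<sigma> * Y z1 + \<tau> * Y z2 = Y z"
      using D Dpos by simp_all
    define m n where "m = round \<sigma>" and "n = round \<tau>"
    have half: "\<bar>\<sigma> - m\<bar> \<le> 1/2" "\<bar>\<tau> - n\<bar> \<le> 1/2"
      using of_int_round_abs_le[of \<sigma>] of_int_round_abs_le[of \<tau>] by (simp_all add: m_def n_def abs_minus_commute)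
    define z' where "z' = (fst z - (p * m + q * n), snd z - (r * m + s * n))"
    have "X z' = X z - m * X z1 - n * X z2" "Y z' = Y z - m * Y z1 - n * Y z2"
      by (simp_all add: z'_def X_def Y_def p_def q_def r_def s_def algebra_simps)
    then have XY': "X z' = (\<sigma> - m) * X z1 + (\<tau> - n) * X z2" "Y z' = (\<sigma> - m) * Y z1 + (\<tau> - n) * Y z2"
      using comb by (simp_all add: algebra_simps)
    have ab: "\<bar>(\<sigma> - m) * u + (\<tau> - n) * v\<bar> \<le> 1/2 * \<bar>u\<bar> + 1/2 * \<bar>v\<bar>" for u v
    proof -
      have "\<bar>(\<sigma> - m) * u\<bar> \<le> 1/2 * \<bar>u\<bar>" "\<bar>(\<tau> - n) * v\<bar> \<le> 1/2 * \<bar>v\<bar>"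
        unfolding abs_mult using half by (intro mult_right_mono; simp)+
      then show ?thesis by linarith
    qed
    have "\<bar>X z'\<bar> < X z1" using ab[of "X z1" "X z2"] X2 XY' by linarith
    moreover have "\<bar>Y z'\<bar> < Y z2" using ab[of "Y z1" "Y z2"] Y1 Y2 XY' by linarith
    ultimately have "z' = 0" using min2[of z'] by (force simp: S2_def)
    then show ?thesis by (intro exI[of _ m] exI[of _ n]) (simp add: z'_def zero_prod_def)
  qed
  \<comment> \<open>Representing both unit vectors inverts the coefficient matrix over the integers,
    so the positive integer \<open>D\<close> divides 1.\<close>
  obtain m1 n1 where 1: "p * m1 + q * n1 = 1" "r * m1 + s * n1 = 0" using span[of "(1, 0)"] by auto
  obtain m2 n2 where 2: "p * m2 + q * n2 = 0" "r * m2 + s * n2 = 1" using span[of "(0, 1)"] by auto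
  have "D * (m1 * n2 - m2 * n1) = (p * m1 + q * n1) * (r * m2 + s * n2) - (p * m2 + q * n2) * (r * m1 + s * n1)"
    by (simp add: D_def algebra_simps)
  then have "D * (m1 * n2 - m2 * n1) = 1" using 1 2 by simp
  then have "D = 1" using Dpos by (metis zmult_eq_1_iff less_minus_one_simps(1) order.asym zero_less_one)
  show thesis
  proof (rule that[of p s q r])
    show "p * s - q * r = 1" using \<open>D = 1\<close> by (simp add: D_def)
  qed (use X1 X2 Y1 Y2 opp in \<open>simp_all add: X_def Y_def p_def q_def r_def s_def\<close>)
qed

section \<open>The group \<open>SL2\<close>\<close>

definition mat2 :: "real \<Rightarrow> real \<Rightarrow> real \<Rightarrow> real \<Rightarrow> real^2^2" where
  "mat2 a b c d = vector [vector [a, b], vector [c, d]]"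

lemma mat2_nth [simp]:
  "mat2 a b c d $ 1 $ 1 = a" "mat2 a b c d $ 1 $ 2 = b"
  "mat2 a b c d $ 2 $ 1 = c" "mat2 a b c d $ 2 $ 2 = d"
  by (simp_all add: mat2_def)

lemma mat2_eq_iff: "(g :: real^2^2) = h \<longleftrightarrow>
    g $ 1 $ 1 = h $ 1 $ 1 \<and> g $ 1 $ 2 = h $ 1 $ 2 \<and> g $ 2 $ 1 = h $ 2 $ 1 \<and> g $ 2 $ 2 = h $ 2 $ 2"
  by (auto simp: vec_eq_iff forall_2)

lemma matrix_mult_nth_2: "((g :: real^2^2) ** h) $ i $ j = g $ i $ 1 * h $ 1 $ j + g $ i $ 2 * h $ 2 $ j"
  by (simp add: matrix_matrix_mult_def sum_2)

lemma matrix_vector_mult_nth_2: "((g :: real^2^2) *v v) $ i = g $ i $ 1 * v $ 1 + g $ i $ 2 * v $ 2"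
  by (simp add: matrix_vector_mult_def sum_2)

lemma mat_1_nth_2: "(mat 1 :: real^2^2) $ i $ j = (if i = j then 1 else 0)"
  by (simp add: mat_def)

definition adj2 :: "real^2^2 \<Rightarrow> real^2^2" where
  "adj2 g = mat2 (g $ 2 $ 2) (- g $ 1 $ 2) (- g $ 2 $ 1) (g $ 1 $ 1)"

lemma adj2_nth [simp]:
  "adj2 g $ 1 $ 1 = g $ 2 $ 2" "adj2 g $ 1 $ 2 = - g $ 1 $ 2"
  "adj2 g $ 2 $ 1 = - g $ 2 $ 1" "adj2 g $ 2 $ 2 = g $ 1 $ 1"
  by (simp_all add: adj2_def)

lemma adj2_adj2 [simp]: "adj2 (adj2 g) = g"
  by (simp add: mat2_eq_iff)

lemma adj2_mult: "adj2 (g ** h) = adj2 h ** adj2 g"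
  by (simp add: mat2_eq_iff matrix_mult_nth_2 algebra_simps)

lemma SL2_iff: "g \<in> SL2 \<longleftrightarrow> g $ 1 $ 1 * g $ 2 $ 2 - g $ 1 $ 2 * g $ 2 $ 1 = 1"
  by (simp add: SL2_def det_2)

lemma adj2_inverse:
  assumes "g \<in> SL2"
  shows "adj2 g ** g = mat 1" "g ** adj2 g = mat 1"
  using assms by (simp_all add: SL2_iff mat2_eq_iff matrix_mult_nth_2 mat_1_nth_2 algebra_simps)

lemma adj2_cancel [simp]:
  assumes "g \<in> SL2"
  shows "adj2 g ** (g ** h) = h" "g ** (adj2 g ** h) = h"
    "adj2 g *v (g *v v) = v" "g *v (adj2 g *v v) = v"
  by (simp_all add: assms matrix_mul_assoc matrix_vector_mul_assoc adj2_inverse)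

lemma SL2_closed [simp, intro]:
  shows SL2_mult: "g \<in> SL2 \<Longrightarrow> h \<in> SL2 \<Longrightarrow> g ** h \<in> SL2"
    and SL2_adj2: "g \<in> SL2 \<Longrightarrow> adj2 g \<in> SL2"
  by (simp_all add: SL2_def det_mul) (simp add: det_2 mult.commute)

lemma continuous_on_mat2 [continuous_intros]:
  assumes "continuous_on S a" "continuous_on S b" "continuous_on S c" "continuous_on S d"
  shows "continuous_on S (\<lambda>x. mat2 (a x) (b x) (c x) (d x))"
proof -
  have "mat2 (a x) (b x) (c x) (d x) =
      (\<chi> i j. if i = 1 then (if j = 1 then a x else b x) else (if j = 1 then c x else d x))" for x
    by (simp add: mat2_eq_iff)
  moreover have "continuous_on S (\<lambda>x. \<chi> i j. if i = (1 :: 2) then (if j = (1 :: 2) then a x else b x) else (if j = 1 then c x else d x))"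
  proof (intro continuous_on_vec_lambda)
    fix i j :: 2
    show "continuous_on S (\<lambda>x. if i = 1 then (if j = 1 then a x else b x) else (if j = 1 then c x else d x))"
      using assms by (cases "i = 1"; cases "j = 1") simp_all
  qed
  ultimately show ?thesis by simp
qed

lemma measurable_mat2 [measurable]:
  assumes [measurable]: "a \<in> borel_measurable M" "b \<in> borel_measurable M" "c \<in> borel_measurable M" "d \<in> borel_measurable M"
  shows "(\<lambda>x. mat2 (a x) (b x) (c x) (d x)) \<in> borel_measurable M"
proof -
  have "continuous_on UNIV (\<lambda>x :: real \<times> real \<times> real \<times> real. mat2 (fst x) (fst (snd x)) (fst (snd (snd x))) (snd (snd (snd x))))"
    by (intro continuous_intros)
  then have [measurable]: "(\<lambda>x :: real \<times> real \<times> real \<times> real. mat2 (fst x) (fst (snd x)) (fst (snd (snd x))) (snd (snd (snd x)))) \<in> borel_measurable borel"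
    by (rule borel_measurable_continuous_onI)
  have [measurable]: "(\<lambda>x. (a x, b x, c x, d x)) \<in> borel_measurable M"
    by (intro borel_measurable_Pair assms)
  show ?thesis
    using measurable_compose[OF \<open>(\<lambda>x. (a x, b x, c x, d x)) \<in> borel_measurable M\<close>
      \<open>(\<lambda>x :: real \<times> real \<times> real \<times> real. mat2 (fst x) (fst (snd x)) (fst (snd (snd x))) (snd (snd (snd x)))) \<in> borel_measurable borel\<close>]
    by simp
qed

lemma measurable_matrix_nth [measurable (raw)]:
  fixes f :: "'a \<Rightarrow> real^2^2"
  assumes "f \<in> borel_measurable M"
  shows "(\<lambda>x. f x $ i $ j) \<in> borel_measurable M"
proof -
  have "(\<lambda>g :: real^2^2. g $ i $ j) \<in> borel_measurable borel"
    by (intro borel_measurable_continuous_onI continuous_intros)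
  from measurable_compose[OF assms this] show ?thesis .
qed

lemma measurable_matrix_mult [measurable (raw)]:
  fixes f g :: "'a \<Rightarrow> real^2^2"
  assumes [measurable]: "f \<in> borel_measurable M" "g \<in> borel_measurable M"
  shows "(\<lambda>x. f x ** g x) \<in> borel_measurable M"
proof -
  have "(\<lambda>x. f x ** g x) = (\<lambda>x. mat2 (f x $ 1 $ 1 * g x $ 1 $ 1 + f x $ 1 $ 2 * g x $ 2 $ 1)
      (f x $ 1 $ 1 * g x $ 1 $ 2 + f x $ 1 $ 2 * g x $ 2 $ 2)
      (f x $ 2 $ 1 * g x $ 1 $ 1 + f x $ 2 $ 2 * g x $ 2 $ 1)
      (f x $ 2 $ 1 * g x $ 1 $ 2 + f x $ 2 $ 2 * g x $ 2 $ 2))"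
    by (simp add: mat2_eq_iff matrix_mult_nth_2 fun_eq_iff)
  also have "\<dots> \<in> borel_measurable M" by measurable
  finally show ?thesis .
qed

lemma measurable_adj2 [measurable]: "adj2 \<in> borel_measurable borel"
  unfolding adj2_def by measurable

lemma SL2_borel [measurable]: "SL2 \<in> sets borel"
proof -
  have "SL2 = {g \<in> space borel. g $ 1 $ 1 * g $ 2 $ 2 - g $ 1 $ 2 * g $ 2 $ 1 = 1}"
    by (auto simp: SL2_iff)
  also have "\<dots> \<in> sets borel" by measurable
  finally show ?thesis .
qed

section \<open>Invariant measure on \<open>SL2\<close>\<close>

text \<open>A matrix with nonzero lower left entry is a product of an upper, a lower and an upper
  shear; if that entry is 0, one lower shear replaces it by the upper left entry, which is then
  nonzero. Invariance is thus needed for shears only, where it is Fubini plus translation.\<close>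

lemma SL2_shear_induct [consumes 1, case_names upper lower mult]:
  assumes g: "g \<in> SL2"
    and upper: "\<And>t. P (mat2 1 t 0 1)" and lower: "\<And>t. P (mat2 1 0 t 1)"
    and mult: "\<And>g h. g \<in> SL2 \<Longrightarrow> h \<in> SL2 \<Longrightarrow> P g \<Longrightarrow> P h \<Longrightarrow> P (g ** h)"
  shows "P g"
proof -
  have SL: "mat2 1 t 0 1 \<in> SL2" "mat2 1 0 t 1 \<in> SL2" for t by (simp_all add: SL2_iff)
  have *: "P h" if h: "h \<in> SL2" and c: "h $ 2 $ 1 \<noteq> 0" for h
  proof -
    define x y where "x = (h $ 1 $ 1 - 1) / h $ 2 $ 1" and "y = (h $ 2 $ 2 - 1) / h $ 2 $ 1"
    have b: "h $ 1 $ 2 = (h $ 1 $ 1 * h $ 2 $ 2 - 1) / h $ 2 $ 1"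
      using h c by (simp add: SL2_iff field_simps)
    have "h = mat2 1 x 0 1 ** (mat2 1 0 (h $ 2 $ 1) 1 ** mat2 1 y 0 1)"
      using c by (simp add: mat2_eq_iff matrix_mult_nth_2 x_def y_def b) (simp add: field_simps)
    then show "P h" by (metis SL SL2_mult mult upper lower)
  qed
  show ?thesis
  proof (cases "g $ 2 $ 1 = 0")
    case False
    then show ?thesis using * g by simp
  next
    case True
    then have "g $ 1 $ 1 \<noteq> 0" using g by (auto simp: SL2_iff)
    with True have "P (mat2 1 0 1 1 ** g)"
      using g SL by (intro *) (auto simp: matrix_mult_nth_2)
    moreover have "g = mat2 1 0 (-1) 1 ** (mat2 1 0 1 1 ** g)"
      by (simp add: mat2_eq_iff matrix_mult_nth_2)
    ultimately show ?thesis by (metis SL(2) SL2_mult mult lower g)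
  qed
qed

lemma nn_integral_lborel_translate:
  fixes f :: "'a :: euclidean_space \<Rightarrow> ennreal"
  assumes [measurable]: "f \<in> borel_measurable borel"
  shows "(\<integral>\<^sup>+x. f (x + c) \<partial>lborel) = (\<integral>\<^sup>+x. f x \<partial>lborel)"
proof -
  have "(\<integral>\<^sup>+x. f x \<partial>lborel) = (\<integral>\<^sup>+x. f x \<partial>distr lborel borel ((+) c))"
    by (simp add: lborel_distr_plus)
  also have "\<dots> = (\<integral>\<^sup>+x. f (c + x) \<partial>lborel)" by (simp add: nn_integral_distr)
  finally show ?thesis by (simp add: add.commute)
qed

lemma nn_integral_lborel_pair:
  fixes f :: "'a :: euclidean_space \<times> 'b :: euclidean_space \<Rightarrow> ennreal"
  assumes "f \<in> borel_measurable borel"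
  shows "(\<integral>\<^sup>+p. f p \<partial>lborel) = (\<integral>\<^sup>+x. \<integral>\<^sup>+y. f (x, y) \<partial>lborel \<partial>lborel)"
    "(\<integral>\<^sup>+p. f p \<partial>lborel) = (\<integral>\<^sup>+y. \<integral>\<^sup>+x. f (x, y) \<partial>lborel \<partial>lborel)"
proof -
  have m: "f \<in> borel_measurable (lborel \<Otimes>\<^sub>M lborel)" using assms by (simp add: lborel_prod)
  have "(\<integral>\<^sup>+p. f p \<partial>(lborel \<Otimes>\<^sub>M lborel)) = (\<integral>\<^sup>+x. \<integral>\<^sup>+y. f (x, y) \<partial>lborel \<partial>lborel)"
    by (rule lborel.nn_integral_fst[OF m, symmetric])
  then show 1: "(\<integral>\<^sup>+p. f p \<partial>lborel) = (\<integral>\<^sup>+x. \<integral>\<^sup>+y. f (x, y) \<partial>lborel \<partial>lborel)"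
    by (simp add: lborel_prod)
  show "(\<integral>\<^sup>+p. f p \<partial>lborel) = (\<integral>\<^sup>+y. \<integral>\<^sup>+x. f (x, y) \<partial>lborel \<partial>lborel)"
    unfolding 1 by (rule lborel_pair.Fubini'[symmetric]) (use m in simp)
qed

text \<open>With one component fixed, a shear translates the other. The component type is arbitrary
  because both uses occur: pairs of rows for left multiplication, pairs of entries of a single row
  for right multiplication.\<close>

lemma nn_integral_lborel_shear:
  fixes f :: "'a :: euclidean_space \<times> 'a \<Rightarrow> ennreal"
  assumes [measurable]: "f \<in> borel_measurable borel"
  shows "(\<integral>\<^sup>+p. f (fst p + t *\<^sub>R snd p, snd p) \<partial>lborel) = (\<integral>\<^sup>+p. f p \<partial>lborel)"
    and "(\<integral>\<^sup>+p. f (fst p, snd p + t *\<^sub>R fst p) \<partial>lborel) = (\<integral>\<^sup>+p. f p \<partial>lborel)"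
proof -
  have [measurable]: "f \<in> borel_measurable (borel \<Otimes>\<^sub>M borel)" by (simp add: borel_prod)
  have s: "(\<lambda>p :: 'a \<times> 'a. (fst p + t *\<^sub>R snd p, snd p)) \<in> borel_measurable borel"
    "(\<lambda>p :: 'a \<times> 'a. (fst p, snd p + t *\<^sub>R fst p)) \<in> borel_measurable borel"
    by (intro borel_measurable_continuous_onI continuous_intros)+
  note m = measurable_compose[OF s(1) assms] measurable_compose[OF s(2) assms]
  have [measurable]: "(\<lambda>x. f (x, y)) \<in> borel_measurable borel" "(\<lambda>x. f (y, x)) \<in> borel_measurable borel" for y
    by measurable
  show "(\<integral>\<^sup>+p. f (fst p + t *\<^sub>R snd p, snd p) \<partial>lborel) = (\<integral>\<^sup>+p. f p \<partial>lborel)"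
    unfolding nn_integral_lborel_pair(2)[OF m(1)] nn_integral_lborel_pair(2)[OF assms]
    by (simp add: nn_integral_lborel_translate[where f = "\<lambda>x. f (x, _)"])
  show "(\<integral>\<^sup>+p. f (fst p, snd p + t *\<^sub>R fst p) \<partial>lborel) = (\<integral>\<^sup>+p. f p \<partial>lborel)"
    unfolding nn_integral_lborel_pair(1)[OF m(2)] nn_integral_lborel_pair(1)[OF assms]
    by (simp add: nn_integral_lborel_translate[where f = "\<lambda>x. f (_, x)"])
qed

text \<open>Right multiplication of a matrix acts by the same map on each row; this passes from one
  row to both.\<close>

lemma nn_integral_lborel_map_prod:
  fixes f :: "'a :: euclidean_space \<times> 'a \<Rightarrow> ennreal" and T :: "'a \<Rightarrow> 'a"
  assumes [measurable]: "f \<in> borel_measurable borel" "T \<in> borel_measurable borel"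
    and T: "\<And>h :: 'a \<Rightarrow> ennreal. h \<in> borel_measurable borel \<Longrightarrow> (\<integral>\<^sup>+x. h (T x) \<partial>lborel) = (\<integral>\<^sup>+x. h x \<partial>lborel)"
  shows "(\<integral>\<^sup>+p. f (T (fst p), T (snd p)) \<partial>lborel) = (\<integral>\<^sup>+p. f p \<partial>lborel)"
proof -
  have [measurable]: "f \<in> borel_measurable (borel \<Otimes>\<^sub>M borel)" by (simp add: borel_prod)
  have [measurable]: "f \<in> borel_measurable (lborel \<Otimes>\<^sub>M lborel)" by (simp add: lborel_prod)
  have "(\<lambda>p. f (T (fst p), T (snd p))) \<in> borel_measurable (borel \<Otimes>\<^sub>M borel)" by measurable
  then have m: "(\<lambda>p. f (T (fst p), T (snd p))) \<in> borel_measurable borel" by (simp add: borel_prod)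
  have "(\<integral>\<^sup>+p. f (T (fst p), T (snd p)) \<partial>lborel) = (\<integral>\<^sup>+x. \<integral>\<^sup>+y. f (T x, T y) \<partial>lborel \<partial>lborel)"
    by (simp add: nn_integral_lborel_pair(1)[OF m])
  also have "\<dots> = (\<integral>\<^sup>+x. \<integral>\<^sup>+y. f (T x, y) \<partial>lborel \<partial>lborel)"
    by (intro nn_integral_cong T) measurable
  also have "\<dots> = (\<integral>\<^sup>+x. \<integral>\<^sup>+y. f (x, y) \<partial>lborel \<partial>lborel)"
    by (rule T[where h = "\<lambda>x. \<integral>\<^sup>+y. f (x, y) \<partial>lborel"]) measurable
  finally show ?thesis by (simp add: nn_integral_lborel_pair(1)[OF assms(1)])
qed

section \<open>The cone measure and its two-sided invariance\<close>

type_synonym rows = "(real \<times> real) \<times> (real \<times> real)"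

definition rdet :: "rows \<Rightarrow> real" where
  "rdet Y = fst (fst Y) * snd (snd Y) - snd (fst Y) * fst (snd Y)"

definition rscale :: "rows \<Rightarrow> real^2^2" where
  "rscale Y = (let t = 1 / sqrt (rdet Y) in
     mat2 (t * fst (fst Y)) (t * snd (fst Y)) (t * fst (snd Y)) (t * snd (snd Y)))"

text \<open>The cone measure: Lebesgue measure on the shell \<open>1 \<le> det \<le> 4\<close> of \<open>2 \<times> 2\<close> matrices, projected
  radially to \<open>SL2\<close>. It inherits invariance from the fact that multiplication by
  an element of \<open>SL2\<close> is a volume-preserving linear map of \<open>\<real>\<^sup>4\<close>.\<close>

definition haar :: "(real^2^2) measure" where
  "haar = distr (density lborel (indicator {Y. 1 \<le> rdet Y \<and> rdet Y \<le> 4})) borel rscale"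

lemma measurable_rdet [measurable]: "rdet \<in> borel_measurable borel"
  unfolding rdet_def by (intro borel_measurable_continuous_onI continuous_intros)

lemma measurable_rows_nth [measurable]:
  "(\<lambda>Y :: rows. fst (fst Y)) \<in> borel_measurable borel" "(\<lambda>Y :: rows. snd (fst Y)) \<in> borel_measurable borel"
  "(\<lambda>Y :: rows. fst (snd Y)) \<in> borel_measurable borel" "(\<lambda>Y :: rows. snd (snd Y)) \<in> borel_measurable borel"
  by (intro borel_measurable_continuous_onI continuous_intros)+

lemma measurable_rscale [measurable]: "rscale \<in> borel_measurable borel"
  unfolding rscale_def Let_def by measurable

lemma rscale_SL2: "rdet Y > 0 \<Longrightarrow> rscale Y \<in> SL2"
  by (simp add: SL2_iff rscale_def Let_def rdet_def[symmetric] right_diff_distrib[symmetric]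
      power2_eq_square[symmetric] field_simps)
    (simp add: rdet_def algebra_simps)

lemma nn_integral_haar:
  assumes [measurable]: "f \<in> borel_measurable borel"
  shows "(\<integral>\<^sup>+g. f g \<partial>haar) = (\<integral>\<^sup>+Y. indicator {Y. 1 \<le> rdet Y \<and> rdet Y \<le> 4} Y * f (rscale Y) \<partial>lborel)"
  unfolding haar_def by (simp add: nn_integral_distr nn_integral_density)

lemma sets_haar [simp, measurable_cong]: "sets haar = sets borel"
  and space_haar [simp]: "space haar = UNIV"
  by (simp_all add: haar_def)

text \<open>A volume-preserving map of the row space that keeps the determinant also keeps the
  shell; if it commutes with the radial projection, invariance descends to
  \<open>haar\<close>.\<close>

lemma haar_invariant_if_rows_invariant:
  assumes f [measurable]: "f \<in> borel_measurable borel"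
    and T: "\<And>F :: rows \<Rightarrow> ennreal. F \<in> borel_measurable borel \<Longrightarrow> (\<integral>\<^sup>+Y. F (T Y) \<partial>lborel) = (\<integral>\<^sup>+Y. F Y \<partial>lborel)"
    and det: "\<And>Y. rdet (T Y) = rdet Y" and s: "\<And>Y. rscale (T Y) = \<phi> (rscale Y)"
    and \<phi> [measurable]: "\<phi> \<in> borel_measurable borel"
  shows "(\<integral>\<^sup>+g. f (\<phi> g) \<partial>haar) = (\<integral>\<^sup>+g. f g \<partial>haar)"
proof -
  let ?F = "\<lambda>Y. indicator {Y. 1 \<le> rdet Y \<and> rdet Y \<le> 4} Y * f (rscale Y) :: ennreal"
  have "(\<integral>\<^sup>+g. f (\<phi> g) \<partial>haar) = (\<integral>\<^sup>+Y. ?F (T Y) \<partial>lborel)"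
    by (simp add: nn_integral_haar det s indicator_def)
  also have "\<dots> = (\<integral>\<^sup>+Y. ?F Y \<partial>lborel)" by (rule T) measurable
  finally show ?thesis by (simp add: nn_integral_haar)
qed

lemma haar_left_invariant:
  assumes "h \<in> SL2" "f \<in> borel_measurable borel"
  shows "(\<integral>\<^sup>+g. f (h ** g) \<partial>haar) = (\<integral>\<^sup>+g. f g \<partial>haar)"
  using assms
proof (induction h arbitrary: f rule: SL2_shear_induct)
  case (upper t)
  show ?case
    by (rule haar_invariant_if_rows_invariant[where T = "\<lambda>Y. (fst Y + t *\<^sub>R snd Y, snd Y)"])
      (use upper in \<open>auto simp: nn_integral_lborel_shear rdet_def rscale_def Let_def mat2_eq_iff matrix_mult_nth_2 algebra_simps\<close>)
next
  case (lower t)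
  show ?case
    by (rule haar_invariant_if_rows_invariant[where T = "\<lambda>Y. (fst Y, snd Y + t *\<^sub>R fst Y)"])
      (use lower in \<open>auto simp: nn_integral_lborel_shear rdet_def rscale_def Let_def mat2_eq_iff matrix_mult_nth_2 algebra_simps\<close>)
next
  case (mult g h)
  note [measurable] = mult.prems
  have "(\<integral>\<^sup>+x. f (g ** h ** x) \<partial>haar) = (\<integral>\<^sup>+x. f (g ** (h ** x)) \<partial>haar)"
    by (simp add: matrix_mul_assoc)
  also have "\<dots> = (\<integral>\<^sup>+x. f (g ** x) \<partial>haar)" by (rule mult.IH(2)) measurable
  finally show ?case using mult by simp
qed

lemma haar_right_invariant:
  assumes "h \<in> SL2" "f \<in> borel_measurable borel"
  shows "(\<integral>\<^sup>+g. f (g ** h) \<partial>haar) = (\<integral>\<^sup>+g. f g \<partial>haar)"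
  using assms
proof (induction h arbitrary: f rule: SL2_shear_induct)
  case (upper t)
  let ?S = "\<lambda>p :: real \<times> real. (fst p, snd p + t *\<^sub>R fst p)"
  have S: "?S \<in> borel_measurable borel" by (intro borel_measurable_continuous_onI continuous_intros)
  show ?case
    by (rule haar_invariant_if_rows_invariant[where T = "\<lambda>Y. (?S (fst Y), ?S (snd Y))"])
      (use upper nn_integral_lborel_map_prod[where T = ?S, OF _ S nn_integral_lborel_shear(2)] in
        \<open>auto simp: rdet_def rscale_def Let_def mat2_eq_iff matrix_mult_nth_2 algebra_simps\<close>)
next
  case (lower t)
  let ?S = "\<lambda>p :: real \<times> real. (fst p + t *\<^sub>R snd p, snd p)"
  have S: "?S \<in> borel_measurable borel" by (intro borel_measurable_continuous_onI continuous_intros)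
  show ?case
    by (rule haar_invariant_if_rows_invariant[where T = "\<lambda>Y. (?S (fst Y), ?S (snd Y))"])
      (use lower nn_integral_lborel_map_prod[where T = ?S, OF _ S nn_integral_lborel_shear(1)] in
        \<open>auto simp: rdet_def rscale_def Let_def mat2_eq_iff matrix_mult_nth_2 algebra_simps\<close>)
next
  case (mult g h)
  note [measurable] = mult.prems
  have "(\<integral>\<^sup>+x. f (x ** (g ** h)) \<partial>haar) = (\<integral>\<^sup>+x. f (x ** g ** h) \<partial>haar)"
    by (simp add: matrix_mul_assoc)
  also have "\<dots> = (\<integral>\<^sup>+x. f (x ** h) \<partial>haar)" by (rule mult.IH(1)[of "\<lambda>x. f (x ** h)"]) measurable
  finally show ?case using mult by simp
qed

section \<open>Volume estimates\<close>

lemma nn_integral_rows: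
  fixes f :: "rows \<Rightarrow> ennreal"
  assumes [measurable]: "f \<in> borel_measurable borel"
  shows "(\<integral>\<^sup>+Y. f Y \<partial>lborel) = (\<integral>\<^sup>+a. \<integral>\<^sup>+b. \<integral>\<^sup>+c. \<integral>\<^sup>+d. f ((a, b), (c, d)) \<partial>lborel \<partial>lborel \<partial>lborel \<partial>lborel)"
proof -
  have [measurable]: "f \<in> borel_measurable (borel \<Otimes>\<^sub>M borel)" by (simp add: borel_prod)
  have "(\<lambda>u. \<integral>\<^sup>+v. f (u, v) \<partial>lborel) \<in> borel_measurable borel" by measurable
  then have "(\<integral>\<^sup>+Y. f Y \<partial>lborel) = (\<integral>\<^sup>+a. \<integral>\<^sup>+b. \<integral>\<^sup>+v. f ((a, b), v) \<partial>lborel \<partial>lborel \<partial>lborel)"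
    by (simp add: nn_integral_lborel_pair(1))
  also have "\<dots> = (\<integral>\<^sup>+a. \<integral>\<^sup>+b. \<integral>\<^sup>+c. \<integral>\<^sup>+d. f ((a, b), (c, d)) \<partial>lborel \<partial>lborel \<partial>lborel \<partial>lborel)"
  proof (intro nn_integral_cong)
    fix a b :: real
    have "(\<lambda>v. f ((a, b), v)) \<in> borel_measurable borel" by measurable
    then show "(\<integral>\<^sup>+v. f ((a, b), v) \<partial>lborel) = (\<integral>\<^sup>+c. \<integral>\<^sup>+d. f ((a, b), (c, d)) \<partial>lborel \<partial>lborel)"
      by (simp add: nn_integral_lborel_pair(1))
  qed
  finally show ?thesis .
qed

text \<open>For fixed \<open>a\<close>, \<open>b\<close>, \<open>c\<close> the determinant is affine
  in \<open>d\<close> with slope \<open>a\<close>. Integrating out \<open>d\<close> over a shell of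
  determinants produces the density 1 / |a|.\<close>

lemma emeasure_affine_preimage_Icc:
  fixes a e p q :: real
  assumes "a \<noteq> 0" "p \<le> q"
  shows "emeasure lborel {d. p \<le> a * d - e \<and> a * d - e \<le> q} = ennreal ((q - p) / \<bar>a\<bar>)"
proof (cases "a > 0")
  case True
  then have "{d. p \<le> a * d - e \<and> a * d - e \<le> q} = {(p + e) / a..(q + e) / a}" by (auto simp: field_simps)
  moreover have "(q + e) / a - (p + e) / a = (q - p) / a" by (simp add: diff_divide_distrib[symmetric])
  ultimately show ?thesis using True assms by (simp add: divide_right_mono)
next
  case False
  then have a: "a < 0" using assms by simp
  then have "{d. p \<le> a * d - e \<and> a * d - e \<le> q} = {(q + e) / a..(p + e) / a}" by (auto simp: field_simps)
  moreover have "(p + e) / a - (q + e) / a = (q - p) / \<bar>a\<bar>" using a by (simp add: field_simps)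
  moreover have "(q + e) / a \<le> (p + e) / a" using a assms by (simp add: divide_right_mono_neg)
  ultimately show ?thesis by simp
qed

lemma emeasure_haar_eq:
  assumes [measurable]: "E \<in> sets borel"
  shows "emeasure haar E = (\<integral>\<^sup>+a. \<integral>\<^sup>+b. \<integral>\<^sup>+c. \<integral>\<^sup>+d.
    indicator {Y. 1 \<le> rdet Y \<and> rdet Y \<le> 4 \<and> rscale Y \<in> E} ((a, b), (c, d)) \<partial>lborel \<partial>lborel \<partial>lborel \<partial>lborel)"
proof -
  have "emeasure haar E = (\<integral>\<^sup>+g. indicator E g \<partial>haar)" by simp
  also have "\<dots> = (\<integral>\<^sup>+Y. indicator {Y. 1 \<le> rdet Y \<and> rdet Y \<le> 4} Y * indicator E (rscale Y) \<partial>lborel)"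
    by (rule nn_integral_haar) measurable
  also have "\<dots> = (\<integral>\<^sup>+Y. indicator {Y. 1 \<le> rdet Y \<and> rdet Y \<le> 4 \<and> rscale Y \<in> E} Y \<partial>lborel)"
    by (intro nn_integral_cong) (auto simp: indicator_def)
  also have "\<dots> = (\<integral>\<^sup>+a. \<integral>\<^sup>+b. \<integral>\<^sup>+c. \<integral>\<^sup>+d.
    indicator {Y. 1 \<le> rdet Y \<and> rdet Y \<le> 4 \<and> rscale Y \<in> E} ((a, b), (c, d)) \<partial>lborel \<partial>lborel \<partial>lborel \<partial>lborel)"
    by (rule nn_integral_rows) measurable
  finally show ?thesis .
qed

text \<open>Here \<open>t\<close> is the square root of the determinant before projection, between 1
  and 2 on the shell, so \<open>A\<close>, \<open>B\<close>, \<open>C\<close> confine the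
  unnormalised entries. The remaining entry contributes 3 / |a|, the 3 being the thickness of the
  shell from 1 to 4; the slice a = 0 is null.\<close>

lemma emeasure_haar_le:
  fixes A :: "real set" and B :: "real \<Rightarrow> real set" and C :: "real \<Rightarrow> real \<Rightarrow> real set"
  assumes "E \<in> sets borel"
    and E: "\<And>t a b c d. \<lbrakk>1 \<le> t; t \<le> 2; mat2 a b c d \<in> E; a * d - b * c = 1; a \<noteq> 0\<rbrakk>
      \<Longrightarrow> t * a \<in> A \<and> t * b \<in> B (t * a) \<and> t * c \<in> C (t * a) (t * b)"
    and meas: "A \<in> sets borel" "\<And>a. B a \<in> sets borel" "\<And>a b. C a b \<in> sets borel"
  shows "emeasure haar E \<le> (\<integral>\<^sup>+a. indicator A a * (\<integral>\<^sup>+b. indicator (B a) b * (ennreal (3 / \<bar>a\<bar>) * emeasure lborel (C a b)) \<partial>lborel) \<partial>lborel)"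
  unfolding emeasure_haar_eq[OF assms(1)]
proof (rule nn_integral_mono_AE)
  let ?I = "indicator {Y. 1 \<le> rdet Y \<and> rdet Y \<le> 4 \<and> rscale Y \<in> E} :: rows \<Rightarrow> ennreal"
  have "AE a in lborel. a \<noteq> (0 :: real)" by (rule AE_lborel_singleton)
  then show "AE a in lborel. (\<integral>\<^sup>+b. \<integral>\<^sup>+c. \<integral>\<^sup>+d. ?I ((a, b), (c, d)) \<partial>lborel \<partial>lborel \<partial>lborel)
    \<le> indicator A a * (\<integral>\<^sup>+b. indicator (B a) b * (ennreal (3 / \<bar>a\<bar>) * emeasure lborel (C a b)) \<partial>lborel)"
  proof eventually_elim
    case (elim a)
    have I: "?I ((a, b), (c, d)) \<le> indicator A a * (indicator (B a) b * (indicator (C a b) c * indicator {d. 1 \<le> a * d - b * c \<and> a * d - b * c \<le> 4} d))"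
      for b c d
    proof (cases "((a, b), (c, d)) \<in> {Y. 1 \<le> rdet Y \<and> rdet Y \<le> 4 \<and> rscale Y \<in> E}")
      case True
      define D t where "D = a * d - b * c" and "t = sqrt D"
      have D: "1 \<le> D" "D \<le> 4" using True by (auto simp: rdet_def D_def)
      then have t: "1 \<le> t" "t \<le> 2" "t * t = D" by (simp_all add: t_def real_le_lsqrt)
      have "mat2 (a / t) (b / t) (c / t) (d / t) \<in> E"
        using True by (simp add: rscale_def Let_def rdet_def D_def[symmetric] t_def[symmetric])
      moreover have "(a / t) * (d / t) - (b / t) * (c / t) = 1"
        using t D by (simp add: diff_divide_distrib[symmetric] D_def[symmetric])
      ultimately have "a \<in> A \<and> b \<in> B a \<and> c \<in> C a b"
        using E[of t "a / t" "b / t" "c / t" "d / t"] t elim by simp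
      then show ?thesis using True by (simp add: rdet_def)
    qed simp
    have "(\<integral>\<^sup>+b. \<integral>\<^sup>+c. \<integral>\<^sup>+d. ?I ((a, b), (c, d)) \<partial>lborel \<partial>lborel \<partial>lborel) \<le>
      (\<integral>\<^sup>+b. \<integral>\<^sup>+c. \<integral>\<^sup>+d. indicator A a * (indicator (B a) b * (indicator (C a b) c * indicator {d. 1 \<le> a * d - b * c \<and> a * d - b * c \<le> 4} d)) \<partial>lborel \<partial>lborel \<partial>lborel)"
      by (intro nn_integral_mono I)
    also have "\<dots> = (\<integral>\<^sup>+b. \<integral>\<^sup>+c. indicator A a * (indicator (B a) b * (indicator (C a b) c * ennreal (3 / \<bar>a\<bar>))) \<partial>lborel \<partial>lborel)"
      using elim by (simp add: nn_integral_cmult emeasure_affine_preimage_Icc)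
    also have "\<dots> = (\<integral>\<^sup>+b. indicator A a * (indicator (B a) b * (ennreal (3 / \<bar>a\<bar>) * emeasure lborel (C a b))) \<partial>lborel)"
      using meas by (simp add: nn_integral_cmult nn_integral_multc mult.commute)
    also have "\<dots> \<le> indicator A a * (\<integral>\<^sup>+b. indicator (B a) b * (ennreal (3 / \<bar>a\<bar>) * emeasure lborel (C a b)) \<partial>lborel)"
      by (cases "a \<in> A") simp_all
    finally show ?case .
  qed
qed

text \<open>Only determinants from 1 to 2 are used. They leave for \<open>d\<close> an interval of
  length 1 / a, at least 1 since \<open>a\<close> is at most 1, so the measure dominates the length
  of \<open>A\<close> times the area described by \<open>B\<close> and \<open>C\<close>.\<close>

lemma emeasure_haar_ge:
  fixes A :: "real set" and B :: "real set" and C :: "real \<Rightarrow> real set"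
  assumes "E \<in> sets borel"
    and E: "\<And>t a b c d. \<lbrakk>a \<in> A; b \<in> B; c \<in> C b; 1 \<le> a * d - b * c; a * d - b * c \<le> 2; t = sqrt (a * d - b * c)\<rbrakk>
      \<Longrightarrow> mat2 (a / t) (b / t) (c / t) (d / t) \<in> E"
    and meas: "A \<in> sets borel" "B \<in> sets borel" "\<And>b. C b \<in> sets borel"
    and A: "\<And>a. a \<in> A \<Longrightarrow> 0 < a \<and> a \<le> 1"
  shows "emeasure lborel A * (\<integral>\<^sup>+b. indicator B b * emeasure lborel (C b) \<partial>lborel) \<le> emeasure haar E"
proof -
  let ?I = "indicator {Y. 1 \<le> rdet Y \<and> rdet Y \<le> 4 \<and> rscale Y \<in> E} :: rows \<Rightarrow> ennreal"
  let ?D = "\<lambda>a b c. {d. 1 \<le> a * d - b * c \<and> a * d - b * c \<le> 2}"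
  have I: "indicator A a * (indicator B b * (indicator (C b) c * indicator (?D a b c) d)) \<le> ?I ((a, b), (c, d))" for a b c d
  proof (cases "a \<in> A \<and> b \<in> B \<and> c \<in> C b \<and> d \<in> ?D a b c")
    case True
    then show ?thesis using E[of a b c d] by (simp add: rdet_def rscale_def Let_def)
  qed auto
  have "emeasure lborel A * (\<integral>\<^sup>+b. indicator B b * emeasure lborel (C b) \<partial>lborel) =
    (\<integral>\<^sup>+a. indicator A a * ((\<integral>\<^sup>+b. indicator B b * emeasure lborel (C b) \<partial>lborel)) \<partial>lborel)"
    using meas by (simp add: nn_integral_multc mult_ac)
  also have "\<dots> \<le> (\<integral>\<^sup>+a. \<integral>\<^sup>+b. \<integral>\<^sup>+c. \<integral>\<^sup>+d. indicator A a * (indicator B b * (indicator (C b) c * indicator (?D a b c) d)) \<partial>lborel \<partial>lborel \<partial>lborel \<partial>lborel)"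
  proof (rule nn_integral_mono)
    fix a :: real
    show "indicator A a * ((\<integral>\<^sup>+b. indicator B b * emeasure lborel (C b) \<partial>lborel)) \<le>
      (\<integral>\<^sup>+b. \<integral>\<^sup>+c. \<integral>\<^sup>+d. indicator A a * (indicator B b * (indicator (C b) c * indicator (?D a b c) d)) \<partial>lborel \<partial>lborel \<partial>lborel)"
    proof (cases "a \<in> A")
      case True
      have a: "0 < a" "a \<le> 1" using A[OF True] by auto
      have "(\<integral>\<^sup>+b. indicator B b * emeasure lborel (C b) \<partial>lborel) \<le> (\<integral>\<^sup>+b. \<integral>\<^sup>+c. indicator B b * (indicator (C b) c * ennreal (1 / a)) \<partial>lborel \<partial>lborel)"
      proof (rule nn_integral_mono)
        fix b
        have "1 \<le> ennreal (1 / a)" using a by (simp add: ennreal_leI[of 1, simplified])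
        then have "emeasure lborel (C b) * 1 \<le> emeasure lborel (C b) * ennreal (1 / a)" by (intro mult_left_mono) auto
        then show "indicator B b * emeasure lborel (C b) \<le> (\<integral>\<^sup>+c. indicator B b * (indicator (C b) c * ennreal (1 / a)) \<partial>lborel)"
          using meas by (simp add: nn_integral_cmult nn_integral_multc mult_left_mono)
      qed
      also have "\<dots> = (\<integral>\<^sup>+b. \<integral>\<^sup>+c. \<integral>\<^sup>+d. indicator A a * (indicator B b * (indicator (C b) c * indicator (?D a b c) d)) \<partial>lborel \<partial>lborel \<partial>lborel)"
        using a True by (simp add: nn_integral_cmult emeasure_affine_preimage_Icc)
      finally show ?thesis using True by simp
    qed simp
  qed
  also have "\<dots> \<le> emeasure haar E"
    unfolding emeasure_haar_eq[OF assms(1)] by (intro nn_integral_mono I)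
  finally show ?thesis .
qed


section \<open>Three regions of \<open>SL2\<close> and their volumes\<close>

lemma nn_integral_const_div:
  fixes k p q :: real
  assumes "0 < p" "p \<le> q" "0 \<le> k"
  shows "(\<integral>\<^sup>+b. indicator {p..q} b * ennreal (k / b) \<partial>lborel) = ennreal (k * ln (q / p))"
proof -
  have "(\<integral>\<^sup>+b. ennreal (k / b) * indicator {p..q} b \<partial>lborel) = ennreal (k * ln q - k * ln p)"
    using assms by (intro nn_integral_FTC_Icc) (auto intro!: derivative_eq_intros)
  then show ?thesis using assms by (simp add: mult.commute ln_div right_diff_distrib)
qed

text \<open>The inner approximation of the preimage of \<open>Uset\<close>. The range of the upper
  left entry \<open>a\<close> makes \<open>s = - ln a\<close> lie between 0 and \<open>ln 2\<close>,
  hence inside the window of times.\<close>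

definition hyp_region :: "real \<Rightarrow> (real^2^2) set" where
  "hyp_region \<delta> = {g \<in> SL2. 1 / 2 \<le> g $ 1 $ 1 \<and> g $ 1 $ 1 \<le> 1 \<and> \<bar>g $ 1 $ 2\<bar> \<le> 1 \<and> \<bar>g $ 2 $ 1\<bar> \<le> 1 \<and>
     - \<delta> \<le> g $ 1 $ 2 * g $ 2 $ 1 \<and> g $ 1 $ 2 * g $ 2 $ 1 \<le> 0}"

text \<open>The outer approximation. In the application \<open>a\<close> lies between exp (-s-r) and
  exp r, which are at least 1/4 and at most 2 because exp 1 is at most 3 and exp r at most 101/100;
  the bound 3 comes from |c| < exp (s-r) and |b| < a.\<close>

definition outer_region :: "real \<Rightarrow> (real^2^2) set" where
  "outer_region \<delta> = {g \<in> SL2. 1 / 4 \<le> g $ 1 $ 1 \<and> g $ 1 $ 1 \<le> 2 \<and> \<bar>g $ 1 $ 2\<bar> \<le> 3 \<and> \<bar>g $ 2 $ 1\<bar> \<le> 3 \<and>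
     \<bar>g $ 1 $ 2 * g $ 2 $ 1\<bar> \<le> \<delta>}"

text \<open>A substitute for a Siegel set. The condition |b| \<le> a cancels the density 1 / a and
  keeps the volume finite as \<open>a\<close> tends to 0. The branch a = 0, a null set, serves the
  lattices containing a nonzero vertical vector.\<close>

definition siegel_region :: "(real^2^2) set" where
  "siegel_region = {g \<in> SL2. g $ 1 $ 1 = 0 \<or>
     (0 < g $ 1 $ 1 \<and> g $ 1 $ 1 \<le> 1 \<and> \<bar>g $ 1 $ 2\<bar> \<le> g $ 1 $ 1 \<and> \<bar>g $ 2 $ 1\<bar> \<le> 1)}"

definition SL2_box :: "nat \<Rightarrow> (real^2^2) set" where
  "SL2_box n = {g \<in> SL2. \<forall>i j. \<bar>g $ i $ j\<bar> \<le> real n}"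

lemma regions_borel [measurable]:
  "hyp_region \<delta> \<in> sets borel" "outer_region \<delta> \<in> sets borel" "siegel_region \<in> sets borel" "SL2_box n \<in> sets borel"
proof -
  have "hyp_region \<delta> = SL2 \<inter> {g \<in> space borel. 1 / 2 \<le> g $ 1 $ 1 \<and> g $ 1 $ 1 \<le> 1 \<and> \<bar>g $ 1 $ 2\<bar> \<le> 1 \<and> \<bar>g $ 2 $ 1\<bar> \<le> 1 \<and>
     - \<delta> \<le> g $ 1 $ 2 * g $ 2 $ 1 \<and> g $ 1 $ 2 * g $ 2 $ 1 \<le> 0}"
    by (auto simp: hyp_region_def)
  also have "\<dots> \<in> sets borel" by measurable
  finally show "hyp_region \<delta> \<in> sets borel" .
  have "outer_region \<delta> = SL2 \<inter> {g \<in> space borel. 1 / 4 \<le> g $ 1 $ 1 \<and> g $ 1 $ 1 \<le> 2 \<and> \<bar>g $ 1 $ 2\<bar> \<le> 3 \<and> \<bar>g $ 2 $ 1\<bar> \<le> 3 \<and>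
     \<bar>g $ 1 $ 2 * g $ 2 $ 1\<bar> \<le> \<delta>}"
    by (auto simp: outer_region_def)
  also have "\<dots> \<in> sets borel" by measurable
  finally show "outer_region \<delta> \<in> sets borel" .
  have "siegel_region = SL2 \<inter> {g \<in> space borel. g $ 1 $ 1 = 0 \<or>
     (0 < g $ 1 $ 1 \<and> g $ 1 $ 1 \<le> 1 \<and> \<bar>g $ 1 $ 2\<bar> \<le> g $ 1 $ 1 \<and> \<bar>g $ 2 $ 1\<bar> \<le> 1)}"
    by (auto simp: siegel_region_def)
  also have "\<dots> \<in> sets borel" by measurable
  finally show "siegel_region \<in> sets borel" .
  have "SL2_box n = SL2 \<inter> {g \<in> space borel. \<forall>i j. \<bar>g $ i $ j\<bar> \<le> real n}"
    by (auto simp: SL2_box_def)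
  also have "\<dots> \<in> sets borel" by measurable
  finally show "SL2_box n \<in> sets borel" .
qed

lemma emeasure_haar_hyp_region:
  assumes "0 < \<delta>" "\<delta> \<le> 1"
  shows "ennreal (\<delta> * ln (1 / \<delta>) / 4) \<le> emeasure haar (hyp_region \<delta>)"
proof -
  \<comment> \<open>Half of the region, \<open>b > 0\<close>, already has the right order. The
    cut-off b \<ge> \<delta> keeps c \<ge> -1, and a \<ge> 3/4 leaves at least 1/2 after division by
    t \<le> 3/2; the final factor 1/4 is the length of this range of \<open>a\<close>.\<close>
  let ?C = "\<lambda>b. {- \<delta> / b..0}"
  have C: "indicator {\<delta>..1} b * emeasure lborel (?C b) = indicator {\<delta>..1} b * ennreal (\<delta> / b)" for b
    using assms by (auto simp: indicator_def)
  have "emeasure lborel {3 / 4..1 :: real} * (\<integral>\<^sup>+b. indicator {\<delta>..1} b * emeasure lborel (?C b) \<partial>lborel)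
    \<le> emeasure haar (hyp_region \<delta>)"
  proof (rule emeasure_haar_ge)
    fix t a b c d :: real
    assume a: "a \<in> {3 / 4..1}" and b: "b \<in> {\<delta>..1}" and c: "c \<in> ?C b"
      and D: "1 \<le> a * d - b * c" "a * d - b * c \<le> 2" and t: "t = sqrt (a * d - b * c)"
    have t1: "1 \<le> t" using D t by simp
    have tt: "t * t = a * d - b * c" using D t by simp
    have "t \<le> 3 / 2" unfolding t using D by (intro real_le_lsqrt) (auto simp: power2_eq_square)
    have b0: "0 < b" "b \<le> 1" using b assms by auto
    have bc: "- \<delta> \<le> b * c" "b * c \<le> 0"
      using c b0 by (auto simp: field_simps mult_nonneg_nonpos)
    have "- 1 \<le> c"
    proof -
      have "- \<delta> / b \<le> c" using c by simp
      moreover have "\<delta> / b \<le> 1" using b b0 by simp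
      ultimately show ?thesis by simp
    qed
    have div: "\<bar>x / t\<bar> \<le> \<bar>x\<bar>" for x using t1 mult_right_mono[of 1 t "\<bar>x\<bar>"] by (simp add: field_simps)
    have "mat2 (a / t) (b / t) (c / t) (d / t) \<in> SL2"
      using t1 tt by (simp add: SL2_iff diff_divide_distrib[symmetric]) (auto simp: mult.commute)
    moreover have "1 / 2 \<le> a / t" using a t1 \<open>t \<le> 3 / 2\<close> by (simp add: field_simps)
    moreover have "a / t \<le> 1" using a t1 by (simp add: field_simps)
    moreover have "\<bar>b / t\<bar> \<le> 1" using div[of b] b0 by linarith
    moreover have "\<bar>c / t\<bar> \<le> 1" using div[of c] c \<open>- 1 \<le> c\<close> by (auto intro: order_trans)
    moreover have "- \<delta> \<le> b / t * (c / t)"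
    proof -
      have "1 \<le> t * t" using D tt by simp
      then have "\<bar>(b * c) / (t * t)\<bar> \<le> \<bar>b * c\<bar>" using mult_right_mono[of 1 "t * t" "\<bar>b * c\<bar>"]
        by (simp add: field_simps abs_mult)
      then show ?thesis using bc by (simp add: abs_le_iff)
    qed
    moreover have "b / t * (c / t) \<le> 0" using bc t1 by (simp add: divide_nonpos_nonneg)
    ultimately show "mat2 (a / t) (b / t) (c / t) (d / t) \<in> hyp_region \<delta>"
      by (simp add: hyp_region_def)
  qed (auto simp: C)
  also have "(\<integral>\<^sup>+b. indicator {\<delta>..1} b * emeasure lborel (?C b) \<partial>lborel) = ennreal (\<delta> * ln (1 / \<delta>))"
    unfolding C using assms by (intro nn_integral_const_div) auto
  also have "emeasure lborel {3 / 4..1 :: real} * ennreal (\<delta> * ln (1 / \<delta>)) = ennreal (\<delta> * ln (1 / \<delta>) / 4)"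
    using assms by (simp add: ennreal_mult[symmetric])
  finally show ?thesis .
qed

text \<open>For each \<open>a\<close> the ranges 2 a of \<open>b\<close> and 4 of \<open>c\<close>,
  times 3 / a, give 24; the range of \<open>a\<close> after rescaling has length 2.\<close>

lemma emeasure_haar_siegel_region: "emeasure haar siegel_region \<le> 48"
proof -
  have "emeasure haar siegel_region \<le> (\<integral>\<^sup>+a. indicator {0<..2} a * (\<integral>\<^sup>+b. indicator {-a..a} b * (ennreal (3 / \<bar>a\<bar>) * emeasure lborel {-2..2 :: real}) \<partial>lborel) \<partial>lborel)"
  proof (rule emeasure_haar_le)
    fix t a b c d :: real
    assume t: "1 \<le> t" "t \<le> 2" and g: "mat2 a b c d \<in> siegel_region" "a \<noteq> 0"
    then have a: "0 < a" "a \<le> 1" "\<bar>b\<bar> \<le> a" "\<bar>c\<bar> \<le> 1" by (auto simp: siegel_region_def)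
    have "t * a \<le> 2 * 1" "t * \<bar>b\<bar> \<le> t * a" "t * \<bar>c\<bar> \<le> 2 * 1"
      using t a by (intro mult_mono mult_left_mono; simp)+
    moreover have "\<bar>t * b\<bar> = t * \<bar>b\<bar>" "\<bar>t * c\<bar> = t * \<bar>c\<bar>" using t by (simp_all add: abs_mult)
    ultimately have "t * a \<le> 2" "\<bar>t * b\<bar> \<le> t * a" "\<bar>t * c\<bar> \<le> 2" "0 < t * a" using t a by simp_all
    then show "t * a \<in> {0<..2} \<and> t * b \<in> {- (t * a)..t * a} \<and> t * c \<in> {-2..2}"
      unfolding greaterThanAtMost_iff atLeastAtMost_iff by linarith
  qed auto
  also have "\<dots> \<le> (\<integral>\<^sup>+a. indicator {0<..2} a * 24 \<partial>(lborel :: real measure))"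
  proof (rule nn_integral_mono)
    fix a :: real
    show "indicator {0<..2} a * (\<integral>\<^sup>+b. indicator {-a..a} b * (ennreal (3 / \<bar>a\<bar>) * emeasure lborel {-2..2 :: real}) \<partial>lborel) \<le> indicator {0<..2} a * (24 :: ennreal)"
    proof (cases "a \<in> {0<..2}")
      case True
      have "(\<integral>\<^sup>+b. indicator {-a..a} b * (ennreal (3 / \<bar>a\<bar>) * emeasure lborel {-2..2 :: real}) \<partial>lborel) = ennreal (2 * a) * (ennreal (3 / a) * ennreal 4)"
        using True by (simp add: nn_integral_multc)
      also have "\<dots> = ennreal 24" using True by (simp add: ennreal_mult[symmetric] flip: ennreal_numeral)
      finally show ?thesis using True by simp
    qed simp
  qed
  also have "\<dots> = ennreal 48" by (simp add: nn_integral_multc ennreal_mult[symmetric] flip: ennreal_numeral)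
  finally show ?thesis by simp
qed

lemma emeasure_haar_SL2_box_finite: "emeasure haar (SL2_box n) < \<infinity>"
proof -
  let ?R = "{Y. 1 \<le> rdet Y \<and> rdet Y \<le> 4 \<and> rscale Y \<in> SL2_box n}"
  let ?K = "2 * real n"
  have "emeasure haar (SL2_box n) = (\<integral>\<^sup>+Y. indicator {Y. 1 \<le> rdet Y \<and> rdet Y \<le> 4} Y * indicator (SL2_box n) (rscale Y) \<partial>lborel)"
    by (subst nn_integral_haar[symmetric]) simp_all
  also have "\<dots> = (\<integral>\<^sup>+Y. indicator ?R Y \<partial>lborel)"
    by (intro nn_integral_cong) (auto simp: indicator_def)
  also have "\<dots> \<le> (\<integral>\<^sup>+Y. indicator (cbox ((-?K, -?K), (-?K, -?K)) ((?K, ?K), (?K, ?K))) Y \<partial>lborel)"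
  proof -
    have "?R \<subseteq> cbox ((-?K, -?K), (-?K, -?K)) ((?K, ?K), (?K, ?K))"
    proof
      fix Y assume "Y \<in> ?R"
      moreover obtain a b c d where Y: "Y = ((a, b), (c, d))" by (metis surj_pair)
      moreover define t where "t = sqrt (rdet Y)"
      ultimately have t: "1 \<le> t" "t \<le> 2" and m: "\<bar>a / t\<bar> \<le> n" "\<bar>b / t\<bar> \<le> n" "\<bar>c / t\<bar> \<le> n" "\<bar>d / t\<bar> \<le> n"
        by (auto simp: real_le_lsqrt rscale_def Let_def SL2_box_def forall_2)
      have "\<bar>x\<bar> \<le> ?K" if "\<bar>x / t\<bar> \<le> n" for x
      proof -
        have "\<bar>x\<bar> = t * \<bar>x / t\<bar>" using t by simp
        also have "\<dots> \<le> 2 * real n" using t that by (intro mult_mono) auto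
        finally show ?thesis .
      qed
      from this[OF m(1)] this[OF m(2)] this[OF m(3)] this[OF m(4)]
      show "Y \<in> cbox ((-?K, -?K), (-?K, -?K)) ((?K, ?K), (?K, ?K))"
        by (auto simp: Y cbox_Pair_eq abs_le_iff)
    qed
    then show ?thesis by (intro nn_integral_mono) (auto simp: indicator_def)
  qed
  also have "\<dots> < \<infinity>" using emeasure_bounded_finite[OF bounded_cbox] by simp
  finally show ?thesis .
qed

lemma nn_integral_const_div_neg:
  fixes k p q :: real
  assumes "0 < p" "p \<le> q" "0 \<le> k"
  shows "(\<integral>\<^sup>+b. indicator {-q..-p} b * ennreal (k / - b) \<partial>lborel) = ennreal (k * ln (q / p))"
proof -
  have "(\<integral>\<^sup>+b. ennreal (k / - b) * indicator {-q..-p} b \<partial>lborel) = ennreal (- k * ln (- (- p)) - (- k * ln (- (- q))))"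
    using assms
    by (intro nn_integral_FTC_Icc[where F = "\<lambda>b. - k * ln (- b)"])
      (auto intro!: derivative_eq_intros divide_nonneg_neg simp: divide_le_0_iff)
  then show ?thesis using assms by (simp add: mult.commute ln_div right_diff_distrib)
qed

text \<open>Undoing the projection enlarges each entry by at most 2 and the product
  \<open>b * c\<close> by at most 4, whence the windows [1/4, 4] and [-6, 6] and the bound
  \<open>?e\<close>. The last factor 15/4 is the length of the window for \<open>a\<close>.\<close>

lemma emeasure_haar_outer_region:
  assumes "0 < \<delta>" "\<delta> \<le> 1"
  shows "emeasure haar (outer_region \<delta>) \<le> ennreal (4320 * \<delta> + 720 * \<delta> * ln (3 / (2 * \<delta>)))"
proof -
  let ?e = "4 * \<delta>"
  let ?C = "\<lambda>b. {c. \<bar>c\<bar> \<le> 6 \<and> \<bar>b * c\<bar> \<le> ?e}"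
  have Cm: "?C b \<in> sets borel" for b :: real by measurable
  have "emeasure haar (outer_region \<delta>) \<le>
    (\<integral>\<^sup>+a. indicator {1/4..4} a * (\<integral>\<^sup>+b. indicator {-6..6} b * (ennreal (3 / \<bar>a\<bar>) * emeasure lborel (?C b)) \<partial>lborel) \<partial>lborel)"
  proof (rule emeasure_haar_le)
    fix t a b c d :: real
    assume t: "1 \<le> t" "t \<le> 2" and g: "mat2 a b c d \<in> outer_region \<delta>" "a \<noteq> 0"
    then have a: "1/4 \<le> a" "a \<le> 2" "\<bar>b\<bar> \<le> 3" "\<bar>c\<bar> \<le> 3" "\<bar>b * c\<bar> \<le> \<delta>" by (auto simp: outer_region_def)
    have "t * t \<le> 2 * 2" using t by (intro mult_mono) auto
    then have "1 * (1/4) \<le> t * a" "t * a \<le> 2 * 2" "t * \<bar>b\<bar> \<le> 2 * 3" "t * \<bar>c\<bar> \<le> 2 * 3" "(t * t) * \<bar>b * c\<bar> \<le> 4 * \<delta>"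
      using t a by (intro mult_mono; simp)+
    moreover have "\<bar>t * b\<bar> = t * \<bar>b\<bar>" "\<bar>t * c\<bar> = t * \<bar>c\<bar>" "\<bar>t * b * (t * c)\<bar> = (t * t) * \<bar>b * c\<bar>"
      using t by (simp_all add: abs_mult)
    ultimately have "1/4 \<le> t * a" "t * a \<le> 4" "\<bar>t * b\<bar> \<le> 6" "\<bar>t * c\<bar> \<le> 6" "\<bar>t * b * (t * c)\<bar> \<le> ?e"
      by simp_all
    then show "t * a \<in> {1/4..4} \<and> t * b \<in> {-6..6} \<and> t * c \<in> ?C (t * b)"
      unfolding atLeastAtMost_iff mem_Collect_eq by linarith
  qed (auto simp: Cm)
  also have "\<dots> \<le> (\<integral>\<^sup>+a. indicator {1/4..4} a * ennreal (1152 * \<delta> + 192 * \<delta> * ln (3 / (2 * \<delta>))) \<partial>(lborel :: real measure))"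
  proof (rule nn_integral_mono)
    fix a :: real
    \<comment> \<open>With 3 / |a| \<le> 12, the strip |b| \<le> \<open>?e\<close> uses the trivial
      length 12 of \<open>?C b\<close>, giving 144; outside it the hyperbola gives the length 2
      \<open>?e\<close> / |b|, the part responsible for the logarithm.\<close>
    let ?K = "\<lambda>b. ennreal 144 * indicator {-?e..?e} b + (indicator {?e..6} b * ennreal (24 * ?e / b) + indicator {-6..-?e} b * ennreal (24 * ?e / - b))"
    have K: "indicator {-6..6} b * (ennreal (3 / \<bar>a\<bar>) * emeasure lborel (?C b)) \<le> ?K b" if a: "1/4 \<le> a" for b
    proof -
      have 3: "ennreal (3 / \<bar>a\<bar>) \<le> ennreal 12" using a by (intro ennreal_leI) (simp add: field_simps)
      have le: "ennreal (3 / \<bar>a\<bar>) * emeasure lborel (?C b) \<le> ennreal (12 * (2 * m))"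
        if "?C b \<subseteq> {-m..m}" "0 \<le> m" for m
      proof -
        have "emeasure lborel (?C b) \<le> emeasure lborel {-m..m}" by (intro emeasure_mono that) auto
        also have "\<dots> = ennreal (2 * m)" using that by simp
        finally have "ennreal (3 / \<bar>a\<bar>) * emeasure lborel (?C b) \<le> ennreal 12 * ennreal (2 * m)"
          using 3 by (intro mult_mono) auto
        also have "ennreal 12 * ennreal (2 * m) = ennreal (12 * (2 * m))" using that by (subst ennreal_mult) auto
        finally show ?thesis .
      qed
      have Csub: "?C b \<subseteq> {- (?e / \<bar>b\<bar>)..?e / \<bar>b\<bar>}" if "b \<noteq> 0"
      proof
        fix c assume "c \<in> ?C b"
        then have "\<bar>c\<bar> \<le> ?e / \<bar>b\<bar>" using that by (simp add: abs_mult pos_le_divide_eq mult.commute)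
        then show "c \<in> {- (?e / \<bar>b\<bar>)..?e / \<bar>b\<bar>}" unfolding atLeastAtMost_iff by linarith
      qed
      consider "b \<notin> {-6..6}" | "\<bar>b\<bar> \<le> ?e" | "?e < b" "b \<le> 6" | "b < - ?e" "- 6 \<le> b" by fastforce
      then show ?thesis
      proof cases
        case 1
        then show ?thesis by simp
      next
        case 2
        have "ennreal (3 / \<bar>a\<bar>) * emeasure lborel (?C b) \<le> ennreal 144" using le[of 6, OF subsetI] by (simp add: abs_le_iff)
        moreover have "b \<in> {-?e..?e}" using 2 by auto
        ultimately have "indicator {-6..6} b * (ennreal (3 / \<bar>a\<bar>) * emeasure lborel (?C b)) \<le> ennreal 144 * indicator {-?e..?e} b"
          by (simp add: indicator_def)
        then show ?thesis by (rule order_trans) (rule le_iff_add[THEN iffD2], blast)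
      next
        case 3
        then have b: "b > 0" using assms by simp
        have "?C b \<subseteq> {- (?e / b)..?e / b}" using Csub b by simp
        then have "ennreal (3 / \<bar>a\<bar>) * emeasure lborel (?C b) \<le> ennreal (12 * (2 * (?e / b)))" using b assms by (intro le) auto
        then show ?thesis using 3 b assms by (simp add: indicator_def)
      next
        case 4
        then have b: "b < 0" using assms by simp
        have "?C b \<subseteq> {- (?e / - b)..?e / - b}" using Csub b by simp
        then have "ennreal (3 / \<bar>a\<bar>) * emeasure lborel (?C b) \<le> ennreal (12 * (2 * (?e / - b)))"
          using b assms by (intro le) (auto simp: divide_le_0_iff)
        then show ?thesis using 4 b assms by (simp add: indicator_def)
      qed
    qed
    have ln0: "0 \<le> ln (3 / (2 * \<delta>))" using assms by simp
    have "(\<integral>\<^sup>+b. ?K b \<partial>lborel) = ennreal 144 * ennreal (2 * ?e) + (ennreal (24 * ?e * ln (6 / ?e)) + ennreal (24 * ?e * ln (6 / ?e)))"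
    proof -
      have "(\<integral>\<^sup>+b. ?K b \<partial>lborel) = (\<integral>\<^sup>+b. ennreal 144 * indicator {-?e..?e} b \<partial>lborel) +
        ((\<integral>\<^sup>+b. indicator {?e..6} b * ennreal (24 * ?e / b) \<partial>lborel) + (\<integral>\<^sup>+b. indicator {-6..-?e} b * ennreal (24 * ?e / - b) \<partial>lborel))"
        by (subst nn_integral_add; (subst nn_integral_add)?; measurable)
      also have "(\<integral>\<^sup>+b. ennreal 144 * indicator {-?e..?e} b \<partial>lborel) = ennreal 144 * ennreal (2 * ?e)"
        using assms by (simp add: nn_integral_cmult)
      also have "(\<integral>\<^sup>+b. indicator {?e..6} b * ennreal (24 * ?e / b) \<partial>lborel) = ennreal (24 * ?e * ln (6 / ?e))"
        using assms by (intro nn_integral_const_div) auto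
      also have "(\<integral>\<^sup>+b. indicator {-6..-?e} b * ennreal (24 * ?e / - b) \<partial>lborel) = ennreal (24 * ?e * ln (6 / ?e))"
        using assms by (intro nn_integral_const_div_neg) auto
      finally show ?thesis .
    qed
    also have "\<dots> = ennreal (144 * (2 * ?e) + (24 * ?e * ln (6 / ?e) + 24 * ?e * ln (6 / ?e)))"
    proof -
      have z: "0 \<le> 24 * ?e * ln (6 / ?e)" and e: "0 \<le> 144 * (2 * ?e)" using assms by simp_all
      have "ennreal 144 * ennreal (2 * ?e) = ennreal (144 * (2 * ?e))" using assms by (subst ennreal_mult) simp_all
      then show ?thesis
        using ennreal_plus[OF z z] ennreal_plus[OF e add_nonneg_nonneg[OF z z]] by (simp only:)
    qed
    also have "144 * (2 * ?e) + (24 * ?e * ln (6 / ?e) + 24 * ?e * ln (6 / ?e)) = 1152 * \<delta> + 192 * \<delta> * ln (3 / (2 * \<delta>))"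
      by simp
    finally have K_int: "(\<integral>\<^sup>+b. ?K b \<partial>lborel) = ennreal (1152 * \<delta> + 192 * \<delta> * ln (3 / (2 * \<delta>)))" .
    show "indicator {1/4..4} a * (\<integral>\<^sup>+b. indicator {-6..6} b * (ennreal (3 / \<bar>a\<bar>) * emeasure lborel (?C b)) \<partial>lborel)
      \<le> indicator {1/4..4} a * ennreal (1152 * \<delta> + 192 * \<delta> * ln (3 / (2 * \<delta>)))"
    proof (cases "a \<in> {1/4..4}")
      case True
      then have "1/4 \<le> a" by simp
      then show ?thesis unfolding K_int[symmetric] by (intro mult_left_mono nn_integral_mono K) auto
    qed simp
  qed
  also have "\<dots> = ennreal (15/4) * ennreal (1152 * \<delta> + 192 * \<delta> * ln (3 / (2 * \<delta>)))"
    by (simp add: nn_integral_multc)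
  also have "\<dots> = ennreal (4320 * \<delta> + 720 * \<delta> * ln (3 / (2 * \<delta>)))"
    using assms by (simp add: ennreal_mult[symmetric] algebra_simps)
  finally show ?thesis .
qed

section \<open>Lifting an invariant measure from lattices to \<open>SL2\<close>\<close>

definition SL2Z :: "(real^2^2) set" where
  "SL2Z = {g \<in> SL2. \<forall>i j. g $ i $ j \<in> \<int>}"

lemma SL2Z_iff: "g \<in> SL2Z \<longleftrightarrow> g \<in> SL2 \<and> g $ 1 $ 1 \<in> \<int> \<and> g $ 1 $ 2 \<in> \<int> \<and> g $ 2 $ 1 \<in> \<int> \<and> g $ 2 $ 2 \<in> \<int>"
  by (auto simp: SL2Z_def forall_2)

lemma Zsq_iff: "v \<in> Zsq \<longleftrightarrow> v $ 1 \<in> \<int> \<and> v $ 2 \<in> \<int>"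
  by (auto simp: Zsq_def forall_2)

lemma SL2Z_adj2: "g \<in> SL2Z \<Longrightarrow> adj2 g \<in> SL2Z"
  by (auto simp: SL2Z_iff)

lemma act_lattice_of: "act h (lattice_of g) = lattice_of (h ** g)"
  by (simp add: act_def lattice_of_def image_image matrix_vector_mul_assoc)

lemma lattice_of_mult_SL2Z:
  assumes "\<gamma> \<in> SL2Z"
  shows "lattice_of (g ** \<gamma>) = lattice_of g"
proof -
  have into: "h *v z \<in> Zsq" if "h \<in> SL2Z" "z \<in> Zsq" for h z
    using that by (auto simp: SL2Z_iff Zsq_iff matrix_vector_mult_nth_2)
  have \<gamma>: "\<gamma> \<in> SL2" using assms by (simp add: SL2Z_iff)
  have "(\<lambda>v. \<gamma> *v v) ` Zsq = Zsq"
  proof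
    show "Zsq \<subseteq> (\<lambda>v. \<gamma> *v v) ` Zsq"
    proof
      fix z assume "z \<in> Zsq"
      then have "adj2 \<gamma> *v z \<in> Zsq" using assms by (intro into SL2Z_adj2)
      moreover have "z = \<gamma> *v (adj2 \<gamma> *v z)" using \<gamma> by simp
      ultimately show "z \<in> (\<lambda>v. \<gamma> *v v) ` Zsq" by blast
    qed
  qed (use into assms in auto)
  then show ?thesis
    by (simp add: lattice_of_def image_image[symmetric] matrix_vector_mul_assoc[symmetric] cong: image_cong_simp)
qed

lemma lattice_of_eqD:
  assumes "g \<in> SL2" "h \<in> SL2" "lattice_of g = lattice_of h"
  shows "adj2 g ** h \<in> SL2Z"
proof -
  have col: "(adj2 g ** h) *v z \<in> Zsq" if "z \<in> Zsq" for z
  proof -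
    have "h *v z \<in> lattice_of g" using that assms(3) by (auto simp: lattice_of_def)
    then obtain w where w: "w \<in> Zsq" "h *v z = g *v w" by (auto simp: lattice_of_def)
    have "(adj2 g ** h) *v z = adj2 g *v (g *v w)" by (simp add: w(2) matrix_vector_mul_assoc[symmetric])
    then show ?thesis using w(1) assms(1) by simp
  qed
  have "vector [1, 0] \<in> Zsq" "vector [0, 1] \<in> Zsq" by (simp_all add: Zsq_iff)
  from col[OF this(1)] col[OF this(2)] show ?thesis
    using assms by (simp add: SL2Z_iff Zsq_iff matrix_vector_mult_nth_2)
qed

lemma fibre_lattice_of:
  assumes "g \<in> SL2"
  shows "{h \<in> SL2 \<inter> E. lattice_of h = lattice_of g} = (\<lambda>\<gamma>. g ** \<gamma>) ` {\<gamma> \<in> SL2Z. g ** \<gamma> \<in> E}"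
proof
  show "{h \<in> SL2 \<inter> E. lattice_of h = lattice_of g} \<subseteq> (\<lambda>\<gamma>. g ** \<gamma>) ` {\<gamma> \<in> SL2Z. g ** \<gamma> \<in> E}"
  proof
    fix h assume h: "h \<in> {h \<in> SL2 \<inter> E. lattice_of h = lattice_of g}"
    then have "adj2 g ** h \<in> SL2Z" using assms by (intro lattice_of_eqD) auto
    moreover have "h = g ** (adj2 g ** h)" using assms by simp
    ultimately show "h \<in> (\<lambda>\<gamma>. g ** \<gamma>) ` {\<gamma> \<in> SL2Z. g ** \<gamma> \<in> E}" using h by (intro image_eqI[of _ _ "adj2 g ** h"]) auto
  qed
qed (use assms in \<open>auto simp: lattice_of_mult_SL2Z SL2Z_iff\<close>)

lemma inj_on_matrix_mult_left: "g \<in> SL2 \<Longrightarrow> inj_on (\<lambda>\<gamma>. g ** \<gamma>) A"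
  by (metis adj2_cancel(1) inj_onI)

lemma countable_SL2Z: "countable SL2Z"
proof -
  have "SL2Z \<subseteq> (\<lambda>(a, b, c, d). mat2 (of_int a) (of_int b) (of_int c) (of_int d)) ` UNIV"
  proof
    fix g assume "g \<in> SL2Z"
    then obtain a b c d where "g $ 1 $ 1 = of_int a" "g $ 1 $ 2 = of_int b" "g $ 2 $ 1 = of_int c" "g $ 2 $ 2 = of_int d"
      by (auto simp: SL2Z_iff elim!: Ints_cases)
    then have "g = mat2 (of_int a) (of_int b) (of_int c) (of_int d)" by (simp add: mat2_eq_iff)
    then show "g \<in> (\<lambda>(a, b, c, d). mat2 (of_int a) (of_int b) (of_int c) (of_int d)) ` UNIV"
      by (intro image_eqI[of _ _ "(a, b, c, d)"]) auto
  qed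
  then show ?thesis by (rule countable_subset) simp
qed

lemma finite_SL2Z_box: "finite (SL2Z \<inter> SL2_box n)"
proof -
  have "SL2Z \<inter> SL2_box n \<subseteq> (\<lambda>(a, b, c, d). mat2 (of_int a) (of_int b) (of_int c) (of_int d)) `
      ({-int n..int n} \<times> {-int n..int n} \<times> {-int n..int n} \<times> {-int n..int n})" (is "_ \<subseteq> ?f ` ?S")
  proof
    fix g assume g: "g \<in> SL2Z \<inter> SL2_box n"
    then obtain a b c d where e: "g $ 1 $ 1 = of_int a" "g $ 1 $ 2 = of_int b" "g $ 2 $ 1 = of_int c" "g $ 2 $ 2 = of_int d"
      by (auto simp: SL2Z_iff elim!: Ints_cases)
    have "\<bar>real_of_int x\<bar> \<le> real n" if "x \<in> {a, b, c, d}" for x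
      using g e that by (auto simp: SL2_box_def forall_2)
    then have "\<bar>x\<bar> \<le> int n" if "x \<in> {a, b, c, d}" for x using that by (metis of_int_abs of_int_le_iff of_int_of_nat_eq)
    then have "(a, b, c, d) \<in> ?S" by (auto simp: abs_le_iff minus_le_iff)
    moreover have "g = ?f (a, b, c, d)" using e by (simp add: mat2_eq_iff)
    ultimately show "g \<in> ?f ` ?S" by blast
  qed
  then show ?thesis by (rule finite_subset) simp
qed

text \<open>If \<open>g\<close> and \<open>g ** \<gamma>\<close> both have entries bounded by
  \<open>n\<close>, then \<gamma>, the inverse of the first times the second, has entries bounded by
  2 n n. Finitely many integral matrices satisfy this, so the box meets each fibre in at most that
  many points.\<close>

definition cover_bound :: "nat \<Rightarrow> nat" where
  "cover_bound n = card (SL2Z \<inter> SL2_box (2 * n * n))"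

text \<open>Phrased through the counting measure, so that infinite fibres have value infinity and
  additivity in \<open>E\<close> is inherited from a measure.\<close>

definition fibre_count :: "(real^2^2) set \<Rightarrow> (real^2) set \<Rightarrow> ennreal" where
  "fibre_count E L = emeasure (count_space UNIV) {g \<in> SL2 \<inter> E. lattice_of g = L}"

lemma fibre_count_le:
  assumes "E \<subseteq> SL2_box n"
  shows "fibre_count E L \<le> of_nat (cover_bound n)"
proof (cases "{g \<in> SL2 \<inter> E. lattice_of g = L} = {}")
  case False
  then obtain g where g: "g \<in> SL2" "g \<in> E" "L = lattice_of g" by auto
  let ?Z = "SL2Z \<inter> SL2_box (2 * n * n)"
  have "{h \<in> SL2 \<inter> E. lattice_of h = L} \<subseteq> (\<lambda>\<gamma>. g ** \<gamma>) ` ?Z"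
  proof
    fix h assume h: "h \<in> {h \<in> SL2 \<inter> E. lattice_of h = L}"
    then have \<gamma>: "adj2 g ** h \<in> SL2Z" using g by (intro lattice_of_eqD) auto
    have b: "\<bar>g $ i $ j\<bar> \<le> n" "\<bar>h $ i $ j\<bar> \<le> n" for i j using g h assms by (auto simp: SL2_box_def)
    have p: "\<bar>x * y + z * w\<bar> \<le> real (2 * n * n)" if "\<bar>x\<bar> \<le> n" "\<bar>y\<bar> \<le> n" "\<bar>z\<bar> \<le> n" "\<bar>w\<bar> \<le> n" for x y z w :: real
    proof -
      have "\<bar>x\<bar> * \<bar>y\<bar> \<le> real n * real n" "\<bar>z\<bar> * \<bar>w\<bar> \<le> real n * real n" using that by (intro mult_mono; simp)+
      then show ?thesis using abs_triangle_ineq[of "x * y" "z * w"] by (simp add: abs_mult)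
    qed
    have "\<bar>adj2 g $ i $ j\<bar> \<le> n" for i j
      using b exhaust_2[of i] exhaust_2[of j] by auto
    then have "adj2 g ** h \<in> SL2_box (2 * n * n)"
      using \<gamma> b by (auto simp: SL2_box_def SL2Z_iff matrix_mult_nth_2 intro!: p simp del: of_nat_mult)
    moreover have "h = g ** (adj2 g ** h)" using g by simp
    ultimately show "h \<in> (\<lambda>\<gamma>. g ** \<gamma>) ` ?Z" using \<gamma> by blast
  qed
  then have "fibre_count E L \<le> emeasure (count_space UNIV) ((\<lambda>\<gamma>. g ** \<gamma>) ` ?Z)"
    unfolding fibre_count_def by (intro emeasure_mono) auto
  also have "\<dots> = of_nat (card ((\<lambda>\<gamma>. g ** \<gamma>) ` ?Z))"
    using finite_SL2Z_box by (intro emeasure_count_space_finite) auto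
  also have "\<dots> = of_nat (cover_bound n)"
    by (simp add: cover_bound_def card_image[OF inj_on_matrix_mult_left[OF g(1)]])
  finally show ?thesis .
next
  case True
  then show ?thesis by (simp only: fibre_count_def) simp
qed

text \<open>The fibre through \<open>g\<close> is the coset of \<open>SL2Z\<close>. As a countable
  sum of indicators, the count is visibly measurable in \<open>g\<close> and compatible with left
  multiplication.\<close>

lemma fibre_count_lattice_of:
  assumes "g \<in> SL2"
  shows "fibre_count E (lattice_of g) = (\<integral>\<^sup>+\<gamma>. indicator E (g ** \<gamma>) \<partial>count_space SL2Z)"
proof -
  have "fibre_count E (lattice_of g) = emeasure (count_space UNIV) ((\<lambda>\<gamma>. g ** \<gamma>) ` {\<gamma> \<in> SL2Z. g ** \<gamma> \<in> E})"
    unfolding fibre_count_def fibre_lattice_of[OF assms] ..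
  also have "\<dots> = emeasure (count_space SL2Z) {\<gamma> \<in> SL2Z. g ** \<gamma> \<in> E}"
    using inj_on_matrix_mult_left[OF assms]
    by (subst (1 2) emeasure_count_space) (auto simp: card_image finite_image_iff)
  also have "\<dots> = (\<integral>\<^sup>+\<gamma>. indicator {\<gamma> \<in> SL2Z. g ** \<gamma> \<in> E} \<gamma> \<partial>count_space SL2Z)" by simp
  also have "\<dots> = (\<integral>\<^sup>+\<gamma>. indicator E (g ** \<gamma>) \<partial>count_space SL2Z)"
    by (intro nn_integral_cong) (auto simp: indicator_def)
  finally show ?thesis .
qed

lemma measurable_fibre_count_lift:
  fixes E :: "(real^2^2) set"
  assumes [measurable]: "E \<in> sets borel"
  shows "(\<lambda>g. \<integral>\<^sup>+\<gamma>. indicator E (g ** \<gamma>) \<partial>count_space SL2Z) \<in> borel_measurable borel"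
proof -
  interpret sigma_finite_measure "count_space SL2Z"
    by (rule sigma_finite_measure_count_space_countable[OF countable_SL2Z])
  have "(\<lambda>p. indicator E (snd p ** fst p) :: ennreal) \<in> borel_measurable (count_space SL2Z \<Otimes>\<^sub>M borel)"
    by (rule measurable_pair_measure_countable1[OF countable_SL2Z]) (simp, measurable)
  then have "(\<lambda>(g, \<gamma>). indicator E (g ** \<gamma>) :: ennreal) \<in> borel_measurable (borel \<Otimes>\<^sub>M count_space SL2Z)"
    by (subst measurable_pair_swap_iff) (simp add: case_prod_beta)
  then show ?thesis by (rule borel_measurable_nn_integral)
qed

section \<open>The left-invariant lift of an invariant probability measure\<close>

locale invariant_prob_lattices =
  fixes M :: "(real^2) set measure"
  assumes invariant: "invariant_prob_X M"
begin

sublocale prob_space M using invariant by (simp add: invariant_prob_X_def)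

lemma space_M [simp]: "space M = Xspace" and sets_M: "sets M = Xsets"
  using invariant by (simp_all add: invariant_prob_X_def)

lemma measurable_M_if_lift:
  fixes f :: "(real^2) set \<Rightarrow> ennreal"
  assumes F: "F \<in> borel_measurable borel" and eq: "\<And>g. g \<in> SL2 \<Longrightarrow> f (lattice_of g) = F g"
  shows "f \<in> borel_measurable M"
proof (rule measurableI)
  fix S :: "ennreal set" assume S: "S \<in> sets borel"
  have "{g \<in> SL2. lattice_of g \<in> f -` S \<inter> Xspace} = SL2 \<inter> (F -` S \<inter> space borel)"
    using eq by (auto simp: Xspace_def)
  also have "\<dots> \<in> sets borel" using measurable_sets[OF F S] by measurable
  finally show "f -` S \<inter> space M \<in> sets M" by (simp add: sets_M Xsets_def)
qed simp

lemma measurable_fibre_count [measurable]: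
  "E \<in> sets borel \<Longrightarrow> fibre_count E \<in> borel_measurable M"
  by (rule measurable_M_if_lift[OF measurable_fibre_count_lift fibre_count_lattice_of])

text \<open>Invariance is given for images of sets. As \<open>adj2 h\<close> acts inversely to
  \<open>h\<close>, preimages are images, so \<open>act h\<close> pushes \<open>M\<close> forward to
  itself and integrals are invariant too.\<close>

lemma nn_integral_act:
  assumes h: "h \<in> SL2" and f: "f \<in> borel_measurable M"
  shows "(\<integral>\<^sup>+L. f (act h L) \<partial>M) = (\<integral>\<^sup>+L. f L \<partial>M)"
proof -
  have actX: "act k L \<in> Xspace" if "k \<in> SL2" "L \<in> Xspace" for k L
    using that by (auto simp: Xspace_def act_lattice_of)
  have cancel: "act h (act (adj2 h) L) = L" "act (adj2 h) (act h L) = L" for L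
    using h by (simp_all add: act_def image_image)
  have meas: "act h \<in> measurable M M"
  proof (rule measurableI)
    fix A assume "A \<in> sets M"
    then have A: "{g \<in> SL2. lattice_of g \<in> A} \<in> sets borel" by (simp add: sets_M Xsets_def)
    have "(\<lambda>g. h ** g) -` {g \<in> SL2. lattice_of g \<in> A} \<inter> space borel \<in> sets borel"
      by (rule measurable_sets[OF _ A]) measurable
    then have "SL2 \<inter> ((\<lambda>g. h ** g) -` {g \<in> SL2. lattice_of g \<in> A}) \<in> sets borel" by auto
    also have "SL2 \<inter> ((\<lambda>g. h ** g) -` {g \<in> SL2. lattice_of g \<in> A}) = {g \<in> SL2. lattice_of g \<in> act h -` A \<inter> Xspace}"
      using h by (auto simp: act_lattice_of Xspace_def)
    finally show "act h -` A \<inter> space M \<in> sets M" by (simp add: sets_M Xsets_def)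
  qed (use h actX in auto)
  have "distr M M (act h) = M"
  proof (rule measure_eqI)
    fix A assume "A \<in> sets (distr M M (act h))"
    then have A: "A \<in> sets M" by simp
    then have AX: "A \<subseteq> Xspace" by (simp add: sets_M Xsets_def)
    have "act h -` A \<inter> Xspace = act (adj2 h) ` A"
    proof
      show "act h -` A \<inter> Xspace \<subseteq> act (adj2 h) ` A" using cancel by (metis IntD1 image_eqI subsetI vimageD)
      show "act (adj2 h) ` A \<subseteq> act h -` A \<inter> Xspace" using h AX cancel actX[of "adj2 h"] by auto
    qed
    then have "emeasure (distr M M (act h)) A = emeasure M (act (adj2 h) ` A)"
      by (simp add: emeasure_distr[OF meas A])
    also have "\<dots> = emeasure M A" using invariant h A by (auto simp: invariant_prob_X_def)
    finally show "emeasure (distr M M (act h)) A = emeasure M A" .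
  qed simp
  then have "(\<integral>\<^sup>+L. f L \<partial>M) = (\<integral>\<^sup>+L. f L \<partial>distr M M (act h))" by simp
  also have "\<dots> = (\<integral>\<^sup>+L. f (act h L) \<partial>M)" by (simp add: nn_integral_distr[OF meas] f)
  finally show ?thesis by simp
qed

definition lifted :: "(real^2^2) measure" where
  "lifted = measure_of UNIV (sets borel) (\<lambda>E. \<integral>\<^sup>+L. fibre_count E L \<partial>M)"

lemma sets_lifted [simp, measurable_cong]: "sets lifted = sets borel"
  and space_lifted [simp]: "space lifted = UNIV"
  using sets.sigma_sets_eq[of "borel :: (real^2^2) measure"] by (simp_all add: lifted_def sets_measure_of space_measure_of)

text \<open>Counts add over disjoint sets, and the integral commutes with series of nonnegative
  functions; hence the set function defining \<open>lifted\<close> is countably additive.\<close>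

lemma emeasure_lifted:
  assumes "E \<in> sets borel"
  shows "emeasure lifted E = (\<integral>\<^sup>+L. fibre_count E L \<partial>M)"
proof (rule emeasure_measure_of[OF lifted_def])
  show "positive (sets lifted) (\<lambda>E. \<integral>\<^sup>+L. fibre_count E L \<partial>M)"
    by (simp add: positive_def fibre_count_def)
  show "countably_additive (sets lifted) (\<lambda>E. \<integral>\<^sup>+L. fibre_count E L \<partial>M)"
  proof (rule countably_additiveI)
    fix A :: "nat \<Rightarrow> (real^2^2) set"
    assume A: "range A \<subseteq> sets lifted" "disjoint_family A"
    have m [measurable]: "fibre_count (A i) \<in> borel_measurable M" for i using A(1) by (intro measurable_fibre_count) auto
    have "(\<Sum>i. \<integral>\<^sup>+L. fibre_count (A i) L \<partial>M) = (\<integral>\<^sup>+L. (\<Sum>i. fibre_count (A i) L) \<partial>M)"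
      by (rule nn_integral_suminf[symmetric]) measurable
    also have "(\<lambda>L. \<Sum>i. fibre_count (A i) L) = fibre_count (\<Union>(range A))"
    proof
      fix L
      have "(\<Sum>i. fibre_count (A i) L) = emeasure (count_space UNIV) (\<Union>i. {g \<in> SL2 \<inter> A i. lattice_of g = L})"
        unfolding fibre_count_def using A(2)
        by (intro suminf_emeasure) (auto simp: disjoint_family_on_def)
      also have "(\<Union>i. {g \<in> SL2 \<inter> A i. lattice_of g = L}) = {g \<in> SL2 \<inter> \<Union>(range A). lattice_of g = L}" by auto
      finally show "(\<Sum>i. fibre_count (A i) L) = fibre_count (\<Union>(range A)) L" by (simp add: fibre_count_def)
    qed
    finally show "(\<Sum>i. \<integral>\<^sup>+L. fibre_count (A i) L \<partial>M) = (\<integral>\<^sup>+L. fibre_count (\<Union>(range A)) L \<partial>M)" .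
  qed
qed (use assms in auto)

lemma emeasure_lifted_box: "E \<in> sets borel \<Longrightarrow> E \<subseteq> SL2_box n \<Longrightarrow> emeasure lifted E \<le> of_nat (cover_bound n)"
proof -
  assume E: "E \<in> sets borel" "E \<subseteq> SL2_box n"
  have "emeasure lifted E \<le> (\<integral>\<^sup>+L. of_nat (cover_bound n) \<partial>M)"
    unfolding emeasure_lifted[OF E(1)] by (intro nn_integral_mono fibre_count_le E)
  then show ?thesis by (simp add: emeasure_space_1[simplified])
qed

lemma emeasure_lifted_compl: "emeasure lifted (- SL2) = 0"
proof -
  have "fibre_count (- SL2) L = 0" for L by (simp add: fibre_count_def)
  then show ?thesis by (simp add: emeasure_lifted)
qed

text \<open>The points over \<open>L\<close> that \<open>h\<close> moves into \<open>E\<close>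
  correspond to the points of \<open>E\<close> over \<open>act h L\<close>; invariance of
  \<open>M\<close> does the rest.\<close>

lemma lifted_left_invariant:
  assumes h: "h \<in> SL2" and f [measurable]: "f \<in> borel_measurable borel"
  shows "(\<integral>\<^sup>+g. f (h ** g) \<partial>lifted) = (\<integral>\<^sup>+g. f g \<partial>lifted)"
proof -
  have "distr lifted borel (\<lambda>g. h ** g) = lifted"
  proof (rule measure_eqI)
    fix E assume "E \<in> sets (distr lifted borel (\<lambda>g. h ** g))"
    then have E [measurable]: "E \<in> sets borel" by simp
    let ?E = "(\<lambda>g. h ** g) -` E"
    have E': "?E \<in> sets borel" using measurable_sets[of "\<lambda>g. h ** g" borel borel E] by simp
    have "fibre_count ?E L = fibre_count E (act h L)" if LX: "L \<in> Xspace" for L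
    proof -
      obtain k where k: "k \<in> SL2" "L = lattice_of k" using LX by (auto simp: Xspace_def)
      show ?thesis using k h by (simp add: act_lattice_of fibre_count_lattice_of matrix_mul_assoc indicator_def)
    qed
    then have "(\<integral>\<^sup>+L. fibre_count ?E L \<partial>M) = (\<integral>\<^sup>+L. fibre_count E (act h L) \<partial>M)"
      by (intro nn_integral_cong) simp
    also have "\<dots> = (\<integral>\<^sup>+L. fibre_count E L \<partial>M)" by (intro nn_integral_act h) measurable
    finally show "emeasure (distr lifted borel (\<lambda>g. h ** g)) E = emeasure lifted E"
      by (simp add: emeasure_distr emeasure_lifted E')
  qed simp
  then have "(\<integral>\<^sup>+g. f g \<partial>lifted) = (\<integral>\<^sup>+g. f g \<partial>distr lifted borel (\<lambda>g. h ** g))" by simp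
  also have "\<dots> = (\<integral>\<^sup>+g. f (h ** g) \<partial>lifted)" by (rule nn_integral_distr) measurable
  finally show ?thesis by simp
qed

end

section \<open>Proportionality of the lifted measure and the cone measure\<close>

lemma sigma_finite_measure_SL2:
  assumes "sets N = sets borel" "emeasure N (- SL2) = 0" "\<And>n. emeasure N (SL2_box n) < \<infinity>"
  shows "sigma_finite_measure N"
proof
  have sp: "space N = UNIV" using sets_eq_imp_space_eq[OF assms(1)] by simp
  have "\<exists>n. g \<in> SL2_box n" if g: "g \<in> SL2" for g
  proof -
    obtain n where n: "\<bar>g $ 1 $ 1\<bar> + \<bar>g $ 1 $ 2\<bar> + \<bar>g $ 2 $ 1\<bar> + \<bar>g $ 2 $ 2\<bar> \<le> real n"
      using real_arch_simple by blast
    then have "g \<in> SL2_box n" using g by (simp add: SL2_box_def forall_2) linarith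
    then show ?thesis ..
  qed
  then have "\<Union>(insert (- SL2) (range SL2_box)) = space N" by (auto simp: sp)
  moreover have "insert (- SL2) (range SL2_box) \<subseteq> sets N" unfolding assms(1) by auto
  moreover have "\<forall>a\<in>insert (- SL2) (range SL2_box). emeasure N a \<noteq> \<infinity>" using assms(2,3) by (auto simp: less_top)
  ultimately show "\<exists>A. countable A \<and> A \<subseteq> sets N \<and> \<Union>A = space N \<and> (\<forall>a\<in>A. emeasure N a \<noteq> \<infinity>)"
    by (intro exI[of _ "insert (- SL2) (range SL2_box)"]) auto
qed

lemma emeasure_haar_compl: "emeasure haar (- SL2) = 0"
proof -
  have "emeasure haar (- SL2) = (\<integral>\<^sup>+Y. indicator {Y. 1 \<le> rdet Y \<and> rdet Y \<le> 4} Y * indicator (- SL2) (rscale Y) \<partial>lborel)"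
    by (subst nn_integral_haar[symmetric]) simp_all
  also have "\<dots> = (\<integral>\<^sup>+Y. 0 \<partial>(lborel :: rows measure))"
    using rscale_SL2 by (intro nn_integral_cong) (auto simp: indicator_def)
  finally show ?thesis by simp
qed

lemma AE_SL2I:
  assumes "sets N = sets borel" "emeasure N (- SL2) = 0"
  shows "AE g in N. g \<in> SL2"
  using assms by (intro AE_I[of _ _ "- SL2"]) auto

context invariant_prob_lattices
begin

text \<open>The classical uniqueness argument for Haar measure: both sides are values of one double integral.\<close>

lemma lifted_haar_cross:
  fixes f k :: "real^2^2 \<Rightarrow> ennreal"
  assumes f [measurable]: "f \<in> borel_measurable borel" and k [measurable]: "k \<in> borel_measurable borel"
  shows "(\<integral>\<^sup>+x. f x \<partial>lifted) * (\<integral>\<^sup>+y. k y \<partial>haar) = (\<integral>\<^sup>+x. k x \<partial>lifted) * (\<integral>\<^sup>+y. f (adj2 y) \<partial>haar)"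
proof -
  interpret L: sigma_finite_measure lifted
    by (intro sigma_finite_measure_SL2 emeasure_lifted_compl le_less_trans[OF emeasure_lifted_box]) (auto simp: of_nat_less_top)
  interpret H: sigma_finite_measure haar
    by (intro sigma_finite_measure_SL2 emeasure_haar_compl emeasure_haar_SL2_box_finite) auto
  interpret P: pair_sigma_finite lifted haar ..
  have L: "AE x in lifted. x \<in> SL2" by (intro AE_SL2I emeasure_lifted_compl) auto
  have H: "AE y in haar. y \<in> SL2" by (intro AE_SL2I emeasure_haar_compl) auto
  have "(\<integral>\<^sup>+x. f x \<partial>lifted) * (\<integral>\<^sup>+y. k y \<partial>haar) = (\<integral>\<^sup>+x. f x * (\<integral>\<^sup>+y. k y \<partial>haar) \<partial>lifted)"
    by (simp add: nn_integral_multc)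
  \<comment> \<open>Right invariance of \<open>haar\<close> inserts \<open>x\<close> into the inner
    integral.\<close>
  also have "\<dots> = (\<integral>\<^sup>+x. \<integral>\<^sup>+y. f x * k (y ** x) \<partial>haar \<partial>lifted)"
    using L by (intro nn_integral_cong_AE) (auto simp: haar_right_invariant nn_integral_cmult)
  also have "\<dots> = (\<integral>\<^sup>+y. \<integral>\<^sup>+x. f x * k (y ** x) \<partial>lifted \<partial>haar)"
    by (rule P.Fubini'[symmetric]) measurable
  \<comment> \<open>Left invariance of \<open>lifted\<close> moves \<open>y\<close> from
    \<open>k\<close> to \<open>f\<close>, as its inverse.\<close>
  also have "\<dots> = (\<integral>\<^sup>+y. \<integral>\<^sup>+x. f (adj2 y ** x) * k x \<partial>lifted \<partial>haar)"
  proof (rule nn_integral_cong_AE, use H in eventually_elim)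
    fix y assume y: "y \<in> SL2"
    show "(\<integral>\<^sup>+x. f x * k (y ** x) \<partial>lifted) = (\<integral>\<^sup>+x. f (adj2 y ** x) * k x \<partial>lifted)"
      using y lifted_left_invariant[OF y, of "\<lambda>x. f (adj2 y ** x) * k x"] by simp
  qed
  also have "\<dots> = (\<integral>\<^sup>+x. \<integral>\<^sup>+y. f (adj2 y ** x) * k x \<partial>haar \<partial>lifted)"
    by (rule P.Fubini') measurable
  \<comment> \<open>Since \<open>adj2 y ** x\<close> is the inverse of \<open>adj2 x ** y\<close>,
    left invariance of \<open>haar\<close> removes \<open>x\<close>. The inversion stays on
    \<open>f\<close>; it is disposed of later by a symmetric test set.\<close>
  also have "\<dots> = (\<integral>\<^sup>+x. k x * (\<integral>\<^sup>+y. f (adj2 y) \<partial>haar) \<partial>lifted)"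
  proof (rule nn_integral_cong_AE, use L in eventually_elim)
    fix x assume x: "x \<in> SL2"
    have "(\<integral>\<^sup>+y. f (adj2 y) \<partial>haar) = (\<integral>\<^sup>+y. f (adj2 (adj2 x ** y)) \<partial>haar)"
      using haar_left_invariant[of "adj2 x" "\<lambda>y. f (adj2 y)"] x by simp
    also have "k x * \<dots> = (\<integral>\<^sup>+y. k x * f (adj2 (adj2 x ** y)) \<partial>haar)"
      by (rule nn_integral_cmult[symmetric]) measurable
    finally show "(\<integral>\<^sup>+y. f (adj2 y ** x) * k x \<partial>haar) = k x * (\<integral>\<^sup>+y. f (adj2 y) \<partial>haar)"
      by (simp add: adj2_mult mult.commute)
  qed
  finally show ?thesis by (simp add: nn_integral_multc)
qed

end

section \<open>Lattices in \<open>Uset\<close>\<close>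

lemma Zsq_eq_range: "Zsq = range (\<lambda>(m :: int, n :: int). vector [of_int m, of_int n])"
proof
  show "Zsq \<subseteq> range (\<lambda>(m :: int, n :: int). vector [of_int m, of_int n])"
  proof
    fix v assume "v \<in> Zsq"
    then obtain m n where "v $ 1 = of_int m" "v $ 2 = of_int n" by (auto simp: Zsq_iff elim!: Ints_cases)
    then have "v = vector [of_int m, of_int n]" by (simp add: vec_eq_iff forall_2)
    then show "v \<in> range (\<lambda>(m :: int, n :: int). vector [of_int m, of_int n])"
      by (intro image_eqI[of _ _ "(m, n)"]) auto
  qed
qed (auto simp: Zsq_iff)

lemma lattice_of_nonzero_iff:
  assumes g: "g \<in> SL2"
  shows "(\<forall>v \<in> lattice_of g - {0}. P v) \<longleftrightarrow> (\<forall>(m :: int) (n :: int). m \<noteq> 0 \<or> n \<noteq> 0 \<longrightarrow> P (g *v vector [of_int m, of_int n]))"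
proof -
  define F where "F m n = g *v vector [of_int m, of_int n]" for m n :: int
  have "g *v z = 0 \<longleftrightarrow> z = 0" for z using g by (metis adj2_cancel(3) matrix_vector_mult_0_right)
  then have zero: "F m n = 0 \<longleftrightarrow> m = 0 \<and> n = 0" for m n by (simp add: F_def vec_eq_iff[of "vector _"] forall_2)
  have "lattice_of g = range (\<lambda>(m, n). F m n)"
    unfolding lattice_of_def Zsq_eq_range by (simp add: F_def image_image case_prod_beta)
  then have "lattice_of g - {0} = {F m n | m n. m \<noteq> 0 \<or> n \<noteq> 0}" using zero by fastforce
  then show ?thesis by (auto simp: F_def)
qed

text \<open>\<open>Delta\<close> is a supremum of reals, so comparing it with \<open>r\<close>
  pointwise requires a nonempty family bounded above. For the bound, a nonzero lattice vector v = g
  z has z integral and recovered from \<open>v\<close> by the inverse matrix, which gives 1 \<le> K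
  |v|.\<close>

lemma Kset_iff:
  assumes g: "g \<in> SL2"
  shows "lattice_of g \<in> Kset r \<longleftrightarrow> (\<forall>(m :: int) (n :: int). m \<noteq> 0 \<or> n \<noteq> 0 \<longrightarrow>
    exp (- r) \<le> max \<bar>g $ 1 $ 1 * of_int m + g $ 1 $ 2 * of_int n\<bar> \<bar>g $ 2 $ 1 * of_int m + g $ 2 $ 2 * of_int n\<bar>)"
proof -
  let ?f = "\<lambda>v :: real^2. ln (1 / infnorm v)"
  define K where "K = \<bar>g $ 1 $ 1\<bar> + \<bar>g $ 1 $ 2\<bar> + \<bar>g $ 2 $ 1\<bar> + \<bar>g $ 2 $ 2\<bar>"
  have low: "1 \<le> K * infnorm v" if v: "v \<in> lattice_of g - {0}" for v
  proof -
    obtain z where z: "z \<in> Zsq" "v = g *v z" using v by (auto simp: lattice_of_def)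
    have "z \<noteq> 0" using z v by (auto simp: matrix_vector_mult_0_right)
    then obtain i where i: "z $ i \<noteq> 0" by (auto simp: vec_eq_iff)
    then have "1 \<le> \<bar>z $ i\<bar>" using z(1) by (auto simp: Zsq_def intro: Ints_nonzero_abs_ge1)
    also have "z = adj2 g *v v" using z(2) g by simp
    also have "\<bar>(adj2 g *v v) $ i\<bar> \<le> \<bar>adj2 g $ i $ 1\<bar> * \<bar>v $ 1\<bar> + \<bar>adj2 g $ i $ 2\<bar> * \<bar>v $ 2\<bar>"
      unfolding matrix_vector_mult_nth_2 using abs_triangle_ineq by (simp add: abs_mult[symmetric])
    also have "\<dots> \<le> \<bar>adj2 g $ i $ 1\<bar> * infnorm v + \<bar>adj2 g $ i $ 2\<bar> * infnorm v"
      by (intro add_mono mult_left_mono) (auto simp: infnorm_2)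
    also have "\<dots> \<le> K * infnorm v"
      unfolding distrib_right[symmetric] using exhaust_2[of i]
      by (intro mult_right_mono) (auto simp: K_def infnorm_pos_le)
    finally show ?thesis .
  qed
  have pos: "0 < infnorm v" if "v \<in> lattice_of g - {0}" for v using that by (simp add: infnorm_pos_lt)
  have "?f v \<le> ln K" if "v \<in> lattice_of g - {0}" for v
  proof -
    have "1 / infnorm v \<le> K" using low[OF that] pos[OF that] by (simp add: field_simps)
    then show ?thesis using pos[OF that] by (intro ln_mono) auto
  qed
  then have bdd: "bdd_above (?f ` (lattice_of g - {0}))" by (auto intro!: bdd_aboveI[of _ "ln K"])
  have "vector [1, 0] \<in> Zsq" by (simp add: Zsq_iff)
  moreover have "g *v vector [1, 0] \<noteq> 0"
    using g by (auto simp: vec_eq_iff forall_2 matrix_vector_mult_nth_2 SL2_iff)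
  ultimately have ne: "lattice_of g - {0} \<noteq> {}" by (auto simp: lattice_of_def)
  have "lattice_of g \<in> Kset r \<longleftrightarrow> Delta (lattice_of g) \<le> r" using g by (auto simp: Kset_def Xspace_def)
  also have "\<dots> \<longleftrightarrow> (\<forall>v \<in> lattice_of g - {0}. ?f v \<le> r)"
    unfolding Delta_def by (rule cSUP_le_iff[OF ne bdd])
  also have "\<dots> \<longleftrightarrow> (\<forall>v \<in> lattice_of g - {0}. exp (- r) \<le> infnorm v)"
  proof (rule ball_cong[OF refl])
    fix v assume "v \<in> lattice_of g - {0}"
    note p = pos[OF this]
    have "?f v \<le> r \<longleftrightarrow> - r \<le> ln (infnorm v)" using p by (simp add: ln_div) linarith
    also have "\<dots> \<longleftrightarrow> exp (- r) \<le> infnorm v" using p by (rule ln_ge_iff)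
    finally show "?f v \<le> r \<longleftrightarrow> exp (- r) \<le> infnorm v" .
  qed
  also have "\<dots> \<longleftrightarrow> (\<forall>(m :: int) (n :: int). m \<noteq> 0 \<or> n \<noteq> 0 \<longrightarrow> exp (- r) \<le> infnorm (g *v vector [of_int m, of_int n]))"
    by (rule lattice_of_nonzero_iff[OF g])
  finally show ?thesis by (simp only: infnorm_2 matrix_vector_mult_nth_2 vector_2)
qed

lemma diag_a_eq: "diag_a s = mat2 (exp s) 0 0 (exp (- s))"
  by (simp add: diag_a_def mat2_eq_iff)

lemma diag_a_SL2: "diag_a s \<in> SL2"
  by (simp add: diag_a_eq SL2_iff exp_add[symmetric])

lemma Uset_iff:
  assumes g: "g \<in> SL2"
  shows "lattice_of g \<in> Uset r \<longleftrightarrow> (\<exists>s\<in>{0..<1}. \<forall>(m :: int) (n :: int). m \<noteq> 0 \<or> n \<noteq> 0 \<longrightarrow>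
    exp (- r) \<le> max (exp s * \<bar>g $ 1 $ 1 * of_int m + g $ 1 $ 2 * of_int n\<bar>) (exp (- s) * \<bar>g $ 2 $ 1 * of_int m + g $ 2 $ 2 * of_int n\<bar>))"
proof -
  note SL = diag_a_SL2
  have adj: "diag_a (- s) = adj2 (diag_a s)" for s by (simp add: diag_a_eq mat2_eq_iff)
  have "lattice_of g \<in> act (diag_a (- s)) ` Kset r \<longleftrightarrow> lattice_of (diag_a s ** g) \<in> Kset r" for s
  proof
    assume "lattice_of g \<in> act (diag_a (- s)) ` Kset r"
    then obtain L where "L \<in> Kset r" "lattice_of g = act (diag_a (- s)) L" by auto
    moreover from this have "lattice_of (diag_a s ** g) = L"
      using SL by (simp add: act_lattice_of[symmetric] adj) (simp add: act_def image_image)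
    ultimately show "lattice_of (diag_a s ** g) \<in> Kset r" by simp
  next
    assume "lattice_of (diag_a s ** g) \<in> Kset r"
    moreover have "lattice_of g = act (diag_a (- s)) (lattice_of (diag_a s ** g))"
      using SL by (simp add: act_lattice_of adj)
    ultimately show "lattice_of g \<in> act (diag_a (- s)) ` Kset r" by blast
  qed
  then have "lattice_of g \<in> Uset r \<longleftrightarrow> (\<exists>s\<in>{0..<1}. lattice_of (diag_a s ** g) \<in> Kset r)"
    unfolding Uset_def by blast
  also have "\<dots> \<longleftrightarrow> (\<exists>s\<in>{0..<1}. \<forall>(m :: int) (n :: int). m \<noteq> 0 \<or> n \<noteq> 0 \<longrightarrow>
    exp (- r) \<le> max (exp s * \<bar>g $ 1 $ 1 * of_int m + g $ 1 $ 2 * of_int n\<bar>) (exp (- s) * \<bar>g $ 2 $ 1 * of_int m + g $ 2 $ 2 * of_int n\<bar>))"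
  proof (rule bex_cong[OF refl])
    fix s :: real
    have e: "\<bar>exp t * x * of_int m + exp t * y * of_int n\<bar> = exp t * \<bar>x * of_int m + y * of_int n\<bar>" for t x y :: real and m n :: int
    proof -
      have "exp t * x * of_int m + exp t * y * of_int n = exp t * (x * of_int m + y * of_int n)" by (simp add: algebra_simps)
      then show ?thesis by (simp add: abs_mult)
    qed
    show "lattice_of (diag_a s ** g) \<in> Kset r \<longleftrightarrow> (\<forall>(m :: int) (n :: int). m \<noteq> 0 \<or> n \<noteq> 0 \<longrightarrow>
      exp (- r) \<le> max (exp s * \<bar>g $ 1 $ 1 * of_int m + g $ 1 $ 2 * of_int n\<bar>) (exp (- s) * \<bar>g $ 2 $ 1 * of_int m + g $ 2 $ 2 * of_int n\<bar>))"
      by (subst Kset_iff) (use SL g in \<open>simp_all add: diag_a_eq matrix_mult_nth_2 e\<close>)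
  qed
  finally show ?thesis .
qed

text \<open>The union over \<open>s\<close> is uncountable. The condition is closed jointly in
  \<open>s\<close> and \<open>g\<close>, projection along a compact range of \<open>s\<close>
  preserves closedness, and [0, 1) is a countable union of compact intervals.\<close>

lemma Uset_measurable: "Uset r \<in> Xsets"
proof -
  define Q where "Q s g \<longleftrightarrow> (\<forall>(m :: int) (n :: int). m \<noteq> 0 \<or> n \<noteq> 0 \<longrightarrow>
    exp (- r) \<le> max (exp s * \<bar>g $ 1 $ 1 * of_int m + g $ 1 $ 2 * of_int n\<bar>) (exp (- s) * \<bar>g $ 2 $ 1 * of_int m + g $ 2 $ 2 * of_int n\<bar>))"
    for s and g :: "real^2^2"
  let ?T = "{p. Q (fst p) (snd p)}"
  have "closed ?T" unfolding Q_def
    by (intro closed_Collect_all closed_Collect_imp open_Collect_const closed_Collect_le continuous_intros)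
  then have cl: "closed {g. \<exists>s. s \<in> {0..1 - 1 / real (Suc k)} \<and> (s, g) \<in> ?T}" for k
    by (intro closed_compact_projection) auto
  have ico: "{0..<1 :: real} = (\<Union>k. {0..1 - 1 / real (Suc k)})"
  proof
    show "{0..<1 :: real} \<subseteq> (\<Union>k. {0..1 - 1 / real (Suc k)})"
    proof
      fix s :: real assume s: "s \<in> {0..<1}"
      then obtain k where "inverse (real (Suc k)) < 1 - s" using reals_Archimedean[of "1 - s"] by auto
      then show "s \<in> (\<Union>k. {0..1 - 1 / real (Suc k)})" using s by (auto simp: inverse_eq_divide intro!: exI[of _ k])
    qed
  next
    show "(\<Union>k. {0..1 - 1 / real (Suc k)}) \<subseteq> {0..<1}" by (auto elim!: order.strict_trans1)
  qed
  have "{g \<in> SL2. lattice_of g \<in> Uset r} = SL2 \<inter> (\<Union>k. {g. \<exists>s. s \<in> {0..1 - 1 / real (Suc k)} \<and> (s, g) \<in> ?T})"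
    (is "?A = ?B")
  proof -
    have "?A = {g \<in> SL2. \<exists>s\<in>{0..<1}. Q s g}" unfolding Q_def by (intro Collect_cong conj_cong refl Uset_iff)
    also have "\<dots> = ?B" unfolding ico by (auto simp: Bex_def)
    finally show ?thesis .
  qed
  also have "\<dots> \<in> sets borel" using cl by (intro sets.Int sets.countable_UN SL2_borel) auto
  finally have "{g \<in> SL2. lattice_of g \<in> Uset r} \<in> sets borel" .
  moreover have "Uset r \<subseteq> Xspace"
    using diag_a_SL2 by (auto simp: Uset_def Kset_def Xspace_def act_lattice_of)
  ultimately show ?thesis by (simp add: Xsets_def)
qed

section \<open>Bases placing lattices in the regions\<close>

lemma mat2_of_int_SL2Z: "p * s - q * r = 1 \<Longrightarrow> mat2 (of_int p) (of_int q) (of_int r) (of_int s) \<in> SL2Z" for p q r s :: int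
  by (simp add: SL2Z_iff SL2_iff flip: of_int_mult of_int_diff)

text \<open>The integers \<open>m\<close>, \<open>n\<close> are returned so that the first column is
  known to be a lattice vector, to which the caller can apply its own lower bounds.\<close>

lemma minimal_points_matrix:
  assumes g: "g \<in> SL2" and \<beta>: "\<beta> > 0"
    and novert: "\<And>(m :: int) (n :: int). m \<noteq> 0 \<or> n \<noteq> 0 \<Longrightarrow> g $ 1 $ 1 * of_int m + g $ 1 $ 2 * of_int n = 0
      \<Longrightarrow> \<beta> \<le> \<bar>g $ 2 $ 1 * of_int m + g $ 2 $ 2 * of_int n\<bar>"
  obtains a b c d and m n :: int where
    "mat2 a b c d \<in> SL2" "lattice_of (mat2 a b c d) = lattice_of g"
    "0 < a" "\<bar>b\<bar> < a" "\<bar>c\<bar> < \<beta>" "\<beta> \<le> d" "b * c \<le> 0" "a * d - b * c = 1"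
    "m \<noteq> 0 \<or> n \<noteq> 0" "a = g $ 1 $ 1 * of_int m + g $ 1 $ 2 * of_int n" "c = g $ 2 $ 1 * of_int m + g $ 2 $ 2 * of_int n"
proof -
  obtain p q u t :: int where pqut: "p * t - q * u = 1" "0 < g $ 1 $ 1 * p + g $ 1 $ 2 * u"
    "\<bar>g $ 1 $ 1 * q + g $ 1 $ 2 * t\<bar> < g $ 1 $ 1 * p + g $ 1 $ 2 * u"
    "\<bar>g $ 2 $ 1 * p + g $ 2 $ 2 * u\<bar> < \<beta>" "\<beta> \<le> g $ 2 $ 1 * q + g $ 2 $ 2 * t"
    "(g $ 1 $ 1 * q + g $ 1 $ 2 * t) * (g $ 2 $ 1 * p + g $ 2 $ 2 * u) \<le> 0"
    using minimal_points_basis[OF g[unfolded SL2_iff] \<beta> novert] by metis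
  define \<gamma> where "\<gamma> = mat2 (of_int p) (of_int q) (of_int u) (of_int t)"
  have \<gamma>: "\<gamma> \<in> SL2Z" unfolding \<gamma>_def by (rule mat2_of_int_SL2Z[OF pqut(1)])
  define a b c d where abcd: "a = g $ 1 $ 1 * p + g $ 1 $ 2 * u" "b = g $ 1 $ 1 * q + g $ 1 $ 2 * t"
    "c = g $ 2 $ 1 * p + g $ 2 $ 2 * u" "d = g $ 2 $ 1 * q + g $ 2 $ 2 * t"
  have eq: "g ** \<gamma> = mat2 a b c d" by (simp add: mat2_eq_iff matrix_mult_nth_2 \<gamma>_def abcd)
  have "g ** \<gamma> \<in> SL2" using g \<gamma> by (auto simp: SL2Z_iff)
  moreover from this have "a * d - b * c = 1" by (simp add: eq SL2_iff)
  moreover have "p \<noteq> 0 \<or> u \<noteq> 0" using pqut(1) by auto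
  ultimately show thesis
    using that[of a b c d p u] pqut(2-6)[folded abcd] lattice_of_mult_SL2Z[OF \<gamma>, of g] abcd(1,3)
    by (simp only: eq)
qed

lemma outer_region_covers_Uset:
  assumes g: "g \<in> SL2" and U: "lattice_of g \<in> Uset r" and r: "0 < r" "r < ln (101 / 100)"
  obtains h where "h \<in> outer_region (2 * r)" "lattice_of h = lattice_of g"
proof -
  obtain s where s: "0 \<le> s" "s < 1" and empty: "\<And>(m :: int) (n :: int). m \<noteq> 0 \<or> n \<noteq> 0 \<Longrightarrow>
    exp (- r) \<le> max (exp s * \<bar>g $ 1 $ 1 * of_int m + g $ 1 $ 2 * of_int n\<bar>) (exp (- s) * \<bar>g $ 2 $ 1 * of_int m + g $ 2 $ 2 * of_int n\<bar>)"
    using U unfolding Uset_iff[OF g] by auto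
  \<comment> \<open>The half-height of the empty box; its half-width is exp (-s-r), as
    \<open>wide\<close> records.\<close>
  define \<beta> where "\<beta> = exp s * exp (- r)"
  have \<beta>: "\<beta> > 0" by (simp add: \<beta>_def)
  have wide: "exp (- s) * exp (- r) \<le> \<bar>g $ 1 $ 1 * of_int m + g $ 1 $ 2 * of_int n\<bar>"
    if "m \<noteq> 0 \<or> n \<noteq> 0" "\<bar>g $ 2 $ 1 * of_int m + g $ 2 $ 2 * of_int n\<bar> < \<beta>" for m n :: int
  proof -
    have "exp (- s) * \<bar>g $ 2 $ 1 * of_int m + g $ 2 $ 2 * of_int n\<bar> < exp (- s) * \<beta>" using that(2) by simp
    also have "exp (- s) * \<beta> = exp (- r)" by (simp add: \<beta>_def exp_minus)
    finally have "exp (- r) \<le> exp s * \<bar>g $ 1 $ 1 * of_int m + g $ 1 $ 2 * of_int n\<bar>" using empty[OF that(1)] by linarith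
    from mult_left_mono[OF this, of "exp (- s)"] show ?thesis
      by (simp add: mult.assoc[symmetric] exp_add[symmetric])
  qed
  have novert: "\<beta> \<le> \<bar>g $ 2 $ 1 * of_int m + g $ 2 $ 2 * of_int n\<bar>"
    if "m \<noteq> 0 \<or> n \<noteq> 0" "g $ 1 $ 1 * of_int m + g $ 1 $ 2 * of_int n = 0" for m n :: int
  proof (rule ccontr)
    assume "\<not> ?thesis"
    then have "exp (- s) * exp (- r) \<le> 0" using wide[OF that(1)] that(2) by simp
    then show False by (simp add: not_le mult_le_0_iff)
  qed
  obtain a b c d and m n :: int where h: "mat2 a b c d \<in> SL2" "lattice_of (mat2 a b c d) = lattice_of g"
    and bounds: "0 < a" "\<bar>b\<bar> < a" "\<bar>c\<bar> < \<beta>" "\<beta> \<le> d" "b * c \<le> 0" and det: "a * d - b * c = 1"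
    and mn: "m \<noteq> 0 \<or> n \<noteq> 0" "a = g $ 1 $ 1 * of_int m + g $ 1 $ 2 * of_int n" "c = g $ 2 $ 1 * of_int m + g $ 2 $ 2 * of_int n"
    using minimal_points_matrix[OF g \<beta> novert] by metis
  have a: "exp (- s) * exp (- r) \<le> a" using wide[OF mn(1)] bounds(1,3) unfolding mn(2,3)[symmetric] by simp
  have er: "1 \<le> exp r" "exp r \<le> 101 / 100"
    using r exp_less_mono[OF r(2)] by auto
  have "exp s \<le> exp 1" using s by simp
  from order_trans[OF this exp_le] have es: "1 \<le> exp s" "exp s \<le> 3" using s by simp_all
  have "exp s * exp r \<le> 3 * (101 / 100)" using es er by (intro mult_mono) auto
  then have "1 / 4 \<le> 1 / (exp s * exp r)" using es er by (intro divide_left_mono) auto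
  also have "\<dots> = exp (- s) * exp (- r)" by (simp add: exp_minus field_simps)
  finally have a1: "1 / 4 \<le> a" using a by simp
  have "exp (- r) \<le> \<beta>" using es by (simp add: \<beta>_def)
  with bounds have d: "exp (- r) \<le> d" by simp
  have ad: "a * d \<le> 1" using det bounds by linarith
  have "a * exp (- r) \<le> 1" using d a1 ad mult_left_mono[OF d, of a] by linarith
  then have "a \<le> exp r" by (simp add: exp_minus field_simps)
  then have a2: "a \<le> 2" using er by simp
  have "\<beta> \<le> 3 * 1" unfolding \<beta>_def using es r by (intro mult_mono) auto
  \<comment> \<open>Both basis vectors clear the box: \<open>a\<close> is at least its half-width
    and \<open>d\<close> at least its half-height. With a d = 1 + b c this bounds -(b c) by 1 - exp
    (-2r), hence by 2r.\<close>
  have "exp (- r) * exp (- r) = (exp (- s) * exp (- r)) * (exp s * exp (- r))" by (simp add: exp_minus field_simps)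
  also have "\<dots> \<le> a * d" using a bounds a1 by (intro mult_mono) (auto simp: \<beta>_def)
  finally have "1 - a * d \<le> 1 - exp (- (2 * r))" by (simp add: exp_add[symmetric])
  also have "\<dots> \<le> 2 * r" using exp_ge_add_one_self[of "- (2 * r)"] by simp
  finally have "\<bar>b * c\<bar> \<le> 2 * r" using det bounds by linarith
  then have "mat2 a b c d \<in> outer_region (2 * r)"
    using h(1) a1 a2 bounds \<open>\<beta> \<le> 3 * 1\<close> by (simp add: outer_region_def)
  then show thesis using that h(2) by blast
qed

text \<open>A vertical lattice vector, made primitive by its gcd, extends to a basis by Bezout and
  gives a = 0. Otherwise minimal points for height 1 have d \<ge> 1 and a d \<le> 1, hence a \<le>
  1.\<close>

lemma siegel_region_covers:
  assumes g: "g \<in> SL2"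
  obtains h where "h \<in> siegel_region" "lattice_of h = lattice_of g"
proof (cases "\<exists>(m :: int) (n :: int). (m \<noteq> 0 \<or> n \<noteq> 0) \<and> g $ 1 $ 1 * of_int m + g $ 1 $ 2 * of_int n = 0")
  case True
  then obtain m n :: int where mn: "m \<noteq> 0 \<or> n \<noteq> 0" "g $ 1 $ 1 * of_int m + g $ 1 $ 2 * of_int n = 0" by blast
  define k where "k = gcd m n"
  have k: "k > 0" using mn(1) by (auto simp: k_def)
  obtain p u where pu: "m = k * p" "n = k * u" by (metis gcd_dvd1 gcd_dvd2 dvdE k_def)
  obtain x y where "x * m + y * n = k" using bezout_int[of m n] by (auto simp: k_def)
  then have "k * (p * x - (- y) * u) = k * 1" by (simp add: pu algebra_simps)
  then have one: "p * x - (- y) * u = 1" using k by simp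
  define \<gamma> where "\<gamma> = mat2 (of_int p) (of_int (- y)) (of_int u) (of_int x)"
  have \<gamma>: "\<gamma> \<in> SL2Z" unfolding \<gamma>_def by (rule mat2_of_int_SL2Z[OF one])
  have "real_of_int k * (g $ 1 $ 1 * p + g $ 1 $ 2 * u) = 0" using mn(2) by (simp add: pu algebra_simps)
  then have "(g ** \<gamma>) $ 1 $ 1 = 0" using k by (simp add: matrix_mult_nth_2 \<gamma>_def)
  then have "g ** \<gamma> \<in> siegel_region" using g \<gamma> by (simp add: siegel_region_def SL2Z_iff)
  then show thesis using that lattice_of_mult_SL2Z[OF \<gamma>] by blast
next
  case False
  obtain a b c d where h: "mat2 a b c d \<in> SL2" "lattice_of (mat2 a b c d) = lattice_of g"
    and bounds: "0 < a" "\<bar>b\<bar> < a" "\<bar>c\<bar> < 1" "1 \<le> d" "b * c \<le> 0" and det: "a * d - b * c = 1"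
    using minimal_points_matrix[OF g, of 1] False by (metis zero_less_one)
  have "a * 1 \<le> a * d" using bounds by (intro mult_left_mono) auto
  also have "\<dots> \<le> 1" using det bounds by linarith
  finally have "mat2 a b c d \<in> siegel_region"
    using h(1) bounds by (simp add: siegel_region_def)
  then show thesis using that h(2) by blast
qed

lemma hyp_region_into_Uset:
  assumes h: "g \<in> hyp_region (1 - exp (- r))" and r: "0 < r"
  shows "lattice_of g \<in> Uset r"
proof -
  define a b c d where "a = g $ 1 $ 1" and "b = g $ 1 $ 2" and "c = g $ 2 $ 1" and "d = g $ 2 $ 2"
  have g: "g \<in> SL2" and a: "1 / 2 \<le> a" "a \<le> 1" and bc: "exp (- r) - 1 \<le> b * c" "b * c \<le> 0"
    using h by (auto simp: hyp_region_def a_def b_def c_def)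
  have det: "a * d - b * c = 1" using g by (simp add: SL2_iff a_def b_def c_def d_def)
  then have ad: "exp (- r) \<le> a * d" using bc by linarith
  define s where "s = - ln a"
  have s: "0 \<le> s" "exp s = 1 / a" "exp (- s) = a" using a by (simp_all add: s_def exp_minus inverse_eq_divide)
  have "ln (1 / 2) \<le> ln a" using a by (intro ln_mono) auto
  then have "s < 1" using ln_2_less_1 by (simp add: s_def ln_div)
  have "exp (- r) \<le> max (exp s * \<bar>a * m + b * n\<bar>) (exp (- s) * \<bar>c * m + d * n\<bar>)" if mn: "m \<noteq> 0 \<or> n \<noteq> 0" for m n :: int
  proof -
    have r1: "exp (- r) \<le> 1" using r by simp
    have le_abs: "\<bar>x\<bar> \<le> \<bar>x + y\<bar>" if "0 \<le> x * y" for x y :: real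
      using that by (auto simp: zero_le_mult_iff abs_if)
    have int1: "1 \<le> \<bar>real_of_int k\<bar>" if "k \<noteq> 0" for k using that by linarith
    show ?thesis
    \<comment> \<open>As b c \<le> 0, the two terms of one coordinate do not cancel. Without
      cancellation in the second, it is at least \<open>d\<close>, and a d \<ge> exp (-r); otherwise
      the first is at least \<open>a\<close>, and exp s = 1 / a.\<close>
    proof (cases "n \<noteq> 0 \<and> 0 \<le> c * m * n")
      case True
      have d: "0 < a * d" using ad exp_gt_zero[of "- r"] by linarith
      then have "0 < d" using a by (simp add: zero_less_mult_iff)
      then have "0 \<le> d * (c * m * n)" using True by simp
      then have "0 \<le> (d * n) * (c * m)" by (simp add: mult_ac)
      from le_abs[OF this] have "d * \<bar>real_of_int n\<bar> \<le> \<bar>c * m + d * n\<bar>" using \<open>0 < d\<close> by (simp add: abs_mult add.commute)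
      moreover have "d * 1 \<le> d * \<bar>real_of_int n\<bar>" using True \<open>0 < d\<close> int1 by (intro mult_left_mono) auto
      ultimately have "a * d \<le> a * \<bar>c * m + d * n\<bar>" using a by (intro mult_left_mono) auto
      then show ?thesis using ad s by simp
    next
      case False
      have "m \<noteq> 0" using False mn by auto
      have "0 \<le> (a * m) * (b * n)"
      proof (cases "n = 0")
        case False
        with \<open>\<not> (n \<noteq> 0 \<and> 0 \<le> c * m * n)\<close> have neg: "c * m * n < 0" by simp
        have "(b * (m * n)) * (c * m * n) = (b * c) * (m * n)\<^sup>2" by (simp add: power2_eq_square algebra_simps)
        also have "\<dots> \<le> 0" using bc(2) by (simp add: mult_nonpos_nonneg)
        finally have "0 \<le> b * (m * n)" using neg by (simp add: mult_le_0_iff)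
        then show ?thesis using a by (simp add: zero_le_mult_iff algebra_simps)
      qed simp
      from le_abs[OF this] have "a * \<bar>real_of_int m\<bar> \<le> \<bar>a * m + b * n\<bar>" using a by (simp add: abs_mult)
      moreover have "a * 1 \<le> a * \<bar>real_of_int m\<bar>" using int1[OF \<open>m \<noteq> 0\<close>] a by (intro mult_left_mono) auto
      ultimately have "exp s * a \<le> exp s * \<bar>a * m + b * n\<bar>" by (intro mult_left_mono) auto
      then have "1 \<le> exp s * \<bar>a * m + b * n\<bar>" using a s(2) by simp
      then show ?thesis using r1 by linarith
    qed
  qed
  then show ?thesis
    unfolding Uset_iff[OF g] a_def b_def c_def d_def using s(1) \<open>s < 1\<close> by (intro bexI[of _ s]) auto
qed

text \<open>The last entry is at most 2 since a d \<le> 1 and a \<ge> 1/2; this fixes the reference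
  box.\<close>

lemma hyp_region_subset_box: "\<delta> \<le> 1 \<Longrightarrow> hyp_region \<delta> \<subseteq> SL2_box 2"
proof
  fix g assume \<delta>: "\<delta> \<le> 1" and "g \<in> hyp_region \<delta>"
  then have g: "g \<in> SL2" "1 / 2 \<le> g $ 1 $ 1" "g $ 1 $ 1 \<le> 1" "\<bar>g $ 1 $ 2\<bar> \<le> 1" "\<bar>g $ 2 $ 1\<bar> \<le> 1"
    "- 1 \<le> g $ 1 $ 2 * g $ 2 $ 1" "g $ 1 $ 2 * g $ 2 $ 1 \<le> 0"
    by (auto simp: hyp_region_def)
  then have ad: "0 \<le> g $ 1 $ 1 * g $ 2 $ 2" "g $ 1 $ 1 * g $ 2 $ 2 \<le> 1" by (auto simp: SL2_iff)
  have d0: "0 \<le> g $ 2 $ 2" using ad(1) g(2) by (simp add: zero_le_mult_iff)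
  have "1 / 2 * g $ 2 $ 2 \<le> g $ 1 $ 1 * g $ 2 $ 2" using g(2) d0 by (intro mult_right_mono)
  then have "g $ 2 $ 2 \<le> 2" using ad by simp
  then show "g \<in> SL2_box 2" using g d0 by (simp add: SL2_box_def forall_2)
qed

lemma emeasure_haar_box_ge: "ennreal (ln 2 / 8) \<le> emeasure haar (SL2_box 2)"
proof -
  have "ennreal (ln 2 / 8) = ennreal (1 / 2 * ln (1 / (1 / 2)) / 4)" by simp
  also have "\<dots> \<le> emeasure haar (hyp_region (1 / 2))" by (rule emeasure_haar_hyp_region) auto
  also have "\<dots> \<le> emeasure haar (SL2_box 2)" using hyp_region_subset_box[of "1 / 2"] by (intro emeasure_mono) auto
  finally show ?thesis .
qed

section \<open>Comparison of the measures and the two final estimates\<close>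

context invariant_prob_lattices
begin

text \<open>Inversion in \<open>SL2\<close> permutes the entries up to sign, so the box is symmetric
  and the inverse in the cross relation disappears.\<close>

lemma lifted_haar_box:
  assumes [measurable]: "E \<in> sets borel"
  shows "emeasure lifted (SL2_box 2) * emeasure haar E = emeasure lifted E * emeasure haar (SL2_box 2)"
proof -
  have "adj2 g \<in> SL2_box 2 \<longleftrightarrow> g \<in> SL2_box 2" for g
    by (auto simp: SL2_box_def forall_2 SL2_iff mult.commute)
  then have ind: "indicator (SL2_box 2) (adj2 g) = (indicator (SL2_box 2) g :: ennreal)" for g
    by (simp add: indicator_def)
  have "(\<integral>\<^sup>+x. indicator (SL2_box 2) x \<partial>lifted) * (\<integral>\<^sup>+y. indicator E y \<partial>haar) =
    (\<integral>\<^sup>+x. indicator E x \<partial>lifted) * (\<integral>\<^sup>+y. indicator (SL2_box 2) (adj2 y) \<partial>haar)"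
    by (rule lifted_haar_cross) measurable
  then show ?thesis by (simp add: ind)
qed

text \<open>The fibre count is at least 1 over \<open>A\<close>. This and the next lemma are the two
  directions of transfer between \<open>M\<close> and \<open>lifted\<close>.\<close>

lemma emeasure_le_lifted:
  assumes [measurable]: "E \<in> sets borel" "A \<in> sets M"
    and cover: "\<And>L. L \<in> A \<Longrightarrow> \<exists>g \<in> SL2 \<inter> E. lattice_of g = L"
  shows "emeasure M A \<le> emeasure lifted E"
proof -
  have "indicator A L \<le> fibre_count E L" for L
  proof (cases "L \<in> A")
    case True
    then obtain g where g: "g \<in> SL2 \<inter> E" "lattice_of g = L" using cover by blast
    have "1 = emeasure (count_space UNIV) {g}" by simp
    also have "\<dots> \<le> fibre_count E L" unfolding fibre_count_def using g by (intro emeasure_mono) auto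
    finally show ?thesis using True by simp
  qed simp
  then have "(\<integral>\<^sup>+L. indicator A L \<partial>M) \<le> (\<integral>\<^sup>+L. fibre_count E L \<partial>M)" by (intro nn_integral_mono)
  then show ?thesis by (simp add: emeasure_lifted)
qed

lemma lifted_le_emeasure:
  assumes [measurable]: "E \<in> sets borel" "A \<in> sets M" and "E \<subseteq> SL2_box n"
    and into: "\<And>g. g \<in> E \<Longrightarrow> lattice_of g \<in> A"
  shows "emeasure lifted E \<le> of_nat (cover_bound n) * emeasure M A"
proof -
  have "fibre_count E L \<le> of_nat (cover_bound n) * indicator A L" for L
  proof (cases "L \<in> A")
    case True
    then show ?thesis using fibre_count_le[OF assms(3)] by simp
  next
    case False
    then have "{g \<in> SL2 \<inter> E. lattice_of g = L} = {}" using into by auto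
    then show ?thesis by (simp only: fibre_count_def) simp
  qed
  then have "(\<integral>\<^sup>+L. fibre_count E L \<partial>M) \<le> (\<integral>\<^sup>+L. of_nat (cover_bound n) * indicator A L \<partial>M)" by (intro nn_integral_mono)
  then show ?thesis by (simp add: emeasure_lifted nn_integral_cmult)
qed

lemma Uset_sets [measurable]: "Uset r \<in> sets M"
  by (simp add: sets_M Uset_measurable)

text \<open>Total mass 1 enters through the covering set: \<open>lifted\<close> gives
  \<open>siegel_region\<close> mass at least 1 while \<open>haar\<close> gives it at most 48.
  Comparing both with the box bounds the factor, and the volume of the box cancels, being finite and
  nonzero.\<close>

lemma haar_le_lifted:
  assumes E: "E \<in> sets borel"
  shows "emeasure haar E \<le> 48 * emeasure lifted E"
proof -
  let ?B = "SL2_box 2"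
  have "1 = emeasure M Xspace" using emeasure_space_1 by simp
  also have "\<dots> \<le> emeasure lifted siegel_region"
  proof (rule emeasure_le_lifted)
    fix L assume "L \<in> Xspace"
    then obtain g where g: "g \<in> SL2" "L = lattice_of g" by (auto simp: Xspace_def)
    obtain h where "h \<in> siegel_region" "lattice_of h = lattice_of g" using siegel_region_covers[OF g(1)] .
    then show "\<exists>h \<in> SL2 \<inter> siegel_region. lattice_of h = L" using g(2) by (auto simp: siegel_region_def)
  qed (use sets.top[of M] in auto)
  finally have "1 * emeasure haar ?B \<le> emeasure lifted siegel_region * emeasure haar ?B" by (intro mult_right_mono) auto
  also have "\<dots> = emeasure lifted ?B * emeasure haar siegel_region" by (rule lifted_haar_box[symmetric]) measurable
  also have "\<dots> \<le> emeasure lifted ?B * 48" by (intro mult_left_mono emeasure_haar_siegel_region) auto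
  finally have *: "emeasure haar ?B \<le> emeasure lifted ?B * 48" by simp
  have "emeasure haar ?B * emeasure haar E \<le> (emeasure lifted ?B * 48) * emeasure haar E"
    using * by (intro mult_right_mono) auto
  also have "\<dots> = 48 * (emeasure lifted ?B * emeasure haar E)" by (simp add: mult_ac)
  also have "\<dots> = emeasure haar ?B * (48 * emeasure lifted E)" unfolding lifted_haar_box[OF E] by (simp add: mult_ac)
  finally have "emeasure haar ?B * emeasure haar E \<le> emeasure haar ?B * (48 * emeasure lifted E)" .
  moreover have "emeasure haar ?B \<noteq> 0"
    using less_le_trans[OF _ emeasure_haar_box_ge, of 0] by simp
  ultimately show ?thesis
    using emeasure_haar_SL2_box_finite[of 2] by (simp add: ennreal_mult_le_mult_iff)
qed

lemma lifted_le_haar: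
  assumes E: "E \<in> sets borel"
  shows "ennreal (ln 2 / 8) * emeasure lifted E \<le> of_nat (cover_bound 2) * emeasure haar E"
proof -
  let ?B = "SL2_box 2"
  have "ennreal (ln 2 / 8) * emeasure lifted E \<le> emeasure haar ?B * emeasure lifted E"
    by (intro mult_right_mono emeasure_haar_box_ge) auto
  also have "\<dots> = emeasure lifted ?B * emeasure haar E" using lifted_haar_box[OF E] by (simp add: mult.commute)
  also have "\<dots> \<le> of_nat (cover_bound 2) * emeasure haar E" by (intro mult_right_mono emeasure_lifted_box) auto
  finally show ?thesis .
qed

lemma measure_Uset_lower:
  assumes r: "0 < r" "r < 1"
  shows "r * ln (1 / r) / 8 \<le> 48 * real (cover_bound 2) * measure M (Uset r)"
proof -
  \<comment> \<open>The largest bound on |b c| for which a d \<ge> exp (-r) is assured; it lies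
    between r / 2 and r.\<close>
  define \<delta> where "\<delta> = 1 - exp (- r)"
  have "exp (- r) \<le> 1 / (1 + r)"
    using exp_ge_add_one_self[of r] r by (simp add: exp_minus inverse_eq_divide frac_le)
  then have "1 - 1 / (1 + r) \<le> \<delta>" by (simp add: \<delta>_def)
  moreover have "1 - 1 / (1 + r) = r / (1 + r)" using r by (simp add: field_simps)
  moreover have "r / 2 \<le> r / (1 + r)" using r by (intro divide_left_mono) auto
  ultimately have \<delta>1: "r / 2 \<le> \<delta>" by linarith
  have \<delta>2: "\<delta> \<le> r" using exp_ge_add_one_self[of "- r"] by (simp add: \<delta>_def)
  have \<delta>: "0 < \<delta>" "\<delta> \<le> 1" using \<delta>1 \<delta>2 r by auto
  have "ln (1 / r) \<le> ln (1 / \<delta>)" using \<delta> \<delta>2 r by (intro ln_mono divide_left_mono) auto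
  then have "r / 2 * ln (1 / r) \<le> \<delta> * ln (1 / \<delta>)" using \<delta>1 r by (intro mult_mono) auto
  then have "ennreal (r * ln (1 / r) / 8) \<le> ennreal (\<delta> * ln (1 / \<delta>) / 4)" by (intro ennreal_leI) simp
  also have "\<dots> \<le> emeasure haar (hyp_region \<delta>)" by (rule emeasure_haar_hyp_region[OF \<delta>])
  also have "\<dots> \<le> 48 * emeasure lifted (hyp_region \<delta>)" by (rule haar_le_lifted) measurable
  also have "\<dots> \<le> 48 * (of_nat (cover_bound 2) * emeasure M (Uset r))"
    using \<delta> r by (intro mult_left_mono lifted_le_emeasure hyp_region_subset_box hyp_region_into_Uset) (auto simp: \<delta>_def)
  also have "\<dots> = ennreal (48 * real (cover_bound 2) * measure M (Uset r))"
    by (simp add: emeasure_eq_measure ennreal_mult ennreal_of_nat_eq_real_of_nat mult.assoc)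
  finally show ?thesis by (simp add: ennreal_le_iff)
qed

lemma measure_Uset_upper:
  assumes r: "0 < r" "r < ln (101 / 100)"
  shows "ln 2 / 8 * measure M (Uset r) \<le> real (cover_bound 2) * (10080 * r * ln (1 / r))"
proof -
  \<comment> \<open>This yields \<open>ln (1 / r)\<close> \<ge> 1, so the linear term is absorbed
    and the coefficients add up to 8640 + 1440 = 10080.\<close>
  have r1: "r \<le> 1 / 100" using r(2) ln_le_minus_one[of "101 / 100"] by simp
  have "exp 1 \<le> 1 / r" using exp_le r r1 by (intro order_trans[OF exp_le]) (simp add: field_simps)
  then have ln1: "1 \<le> ln (1 / r)" using r by (simp add: ln_ge_iff)
  have ln2: "ln (3 / (2 * (2 * r))) \<le> ln (1 / r)" using r by (intro ln_mono) (auto simp: field_simps)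
  have "4320 * (2 * r) + 720 * (2 * r) * ln (3 / (2 * (2 * r))) \<le> 8640 * r * ln (1 / r) + 1440 * r * ln (1 / r)"
  proof (intro add_mono)
    show "4320 * (2 * r) \<le> 8640 * r * ln (1 / r)" using mult_left_mono[OF ln1, of "8640 * r"] r by simp
    show "720 * (2 * r) * ln (3 / (2 * (2 * r))) \<le> 1440 * r * ln (1 / r)"
      using mult_left_mono[OF ln2, of "1440 * r"] r by simp
  qed
  then have le: "4320 * (2 * r) + 720 * (2 * r) * ln (3 / (2 * (2 * r))) \<le> 10080 * r * ln (1 / r)" by simp
  have "emeasure M (Uset r) \<le> emeasure lifted (outer_region (2 * r))"
  proof (rule emeasure_le_lifted)
    fix L assume L: "L \<in> Uset r"
    then have "L \<in> Xspace" using sets.sets_into_space[OF Uset_sets[of r]] by auto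
    then obtain g where g: "g \<in> SL2" "L = lattice_of g" by (auto simp: Xspace_def)
    obtain h where "h \<in> outer_region (2 * r)" "lattice_of h = lattice_of g"
      using outer_region_covers_Uset[OF g(1) _ r] L g(2) by blast
    then show "\<exists>h \<in> SL2 \<inter> outer_region (2 * r). lattice_of h = L" using g(2) by (auto simp: outer_region_def)
  qed measurable
  then have "ennreal (ln 2 / 8) * emeasure M (Uset r) \<le> ennreal (ln 2 / 8) * emeasure lifted (outer_region (2 * r))"
    by (intro mult_left_mono) auto
  also have "\<dots> \<le> of_nat (cover_bound 2) * emeasure haar (outer_region (2 * r))" by (rule lifted_le_haar) measurable
  also have "\<dots> \<le> of_nat (cover_bound 2) * ennreal (4320 * (2 * r) + 720 * (2 * r) * ln (3 / (2 * (2 * r))))"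
    using r r1 by (intro mult_left_mono emeasure_haar_outer_region) auto
  also have "\<dots> \<le> of_nat (cover_bound 2) * ennreal (10080 * r * ln (1 / r))"
    by (intro mult_left_mono ennreal_leI le) auto
  finally have "ennreal (ln 2 / 8 * measure M (Uset r)) \<le> ennreal (real (cover_bound 2) * (10080 * r * ln (1 / r)))"
  proof -
    have "0 \<le> 10080 * r * ln (1 / r)" using r r1 by (intro mult_nonneg_nonneg) auto
    moreover assume *: "ennreal (ln 2 / 8) * emeasure M (Uset r) \<le> of_nat (cover_bound 2) * ennreal (10080 * r * ln (1 / r))"
    ultimately have "ennreal (ln 2 / 8 * measure M (Uset r)) = ennreal (ln 2 / 8) * ennreal (measure M (Uset r))"
      "ennreal (real (cover_bound 2) * (10080 * r * ln (1 / r))) = ennreal (real (cover_bound 2)) * ennreal (10080 * r * ln (1 / r))"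
      by (intro ennreal_mult; simp)+
    with * show ?thesis by (simp only: emeasure_eq_measure ennreal_of_nat_eq_real_of_nat)
  qed
  moreover have "0 \<le> real (cover_bound 2) * (10080 * r * ln (1 / r))" using r r1 by (intro mult_nonneg_nonneg) auto
  ultimately show ?thesis by (simp add: ennreal_le_iff)
qed

end

theorem theorem1p3:
  shows "\<exists>c>0. \<exists>C>0. \<forall>M r. invariant_prob_X M \<and> 0 < r \<and> r < ln (101 / 100) \<longrightarrow>
           c * r * ln (1 / r) \<le> measure M (Uset r) \<and>
           measure M (Uset r) \<le> C * r * ln (1 / r)"
proof -
  \<comment> \<open>Adding 1 makes \<open>N\<close> positive at once, so it can be divided by. The
    factors below are 384 = 8 * 48 and 80640 = 8 * 10080.\<close>
  define N where "N = real (cover_bound 2) + 1"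
  have N: "N > 0" by (simp add: N_def)
  define c C where "c = 1 / (384 * N)" and "C = 80640 * N / ln 2"
  have "c * r * ln (1 / r) \<le> measure M (Uset r) \<and> measure M (Uset r) \<le> C * r * ln (1 / r)"
    if "invariant_prob_X M" "0 < r" "r < ln (101 / 100)" for M r
  proof -
    interpret invariant_prob_lattices M by standard (rule that(1))
    have r1: "r < 1" using that(3) ln_le_minus_one[of "101 / 100"] by simp
    then have ln0: "0 \<le> r * ln (1 / r)" using that(2) by simp
    have "r * ln (1 / r) / 8 \<le> 48 * real (cover_bound 2) * measure M (Uset r)"
      by (rule measure_Uset_lower[OF that(2) r1])
    also have "\<dots> \<le> 48 * N * measure M (Uset r)" by (intro mult_right_mono) (auto simp: N_def)
    finally have "c * r * ln (1 / r) \<le> measure M (Uset r)" using N by (simp add: c_def field_simps)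
    moreover have "measure M (Uset r) \<le> C * r * ln (1 / r)"
    proof -
      have "ln 2 / 8 * measure M (Uset r) \<le> real (cover_bound 2) * (10080 * r * ln (1 / r))"
        by (rule measure_Uset_upper[OF that(2,3)])
      also have "\<dots> \<le> N * (10080 * r * ln (1 / r))" using ln0 by (intro mult_right_mono) (auto simp: N_def)
      finally show ?thesis by (simp add: C_def field_simps)
    qed
    ultimately show ?thesis ..
  qed
  moreover have "c > 0" "C > 0" using N by (simp_all add: c_def C_def)
  ultimately show ?thesis by blast
qed

end
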